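(* Let $\mathcal{R}$ be a commutative ring with identity, let $\mathfrak{A}=\mathrm{Tri}(\mathcal{A},\mathcal{M},\mathcal{B})$ be a triangular algebra over $\mathcal{R}$, and let $\mathcal{L}=\{L_n\}_{n\in\mathbb{N}}$ be a Lie higher derivation on $\mathfrak{A}$. Then there exists a triangular algebra $\mathfrak{A}^{0}$ over $\mathcal{R}$ such that $\mathfrak{A}$ is a subalgebra of $\mathfrak{A}^{0}$ having the same identity, and such that for each $n\in\mathbb{N}$ the map $L_n$ can be written as $L_n=\Delta_n+\chi_n$, where $\{\Delta_n\}_{n\in\mathbb{N}}$, $\Delta_n:\mathfrak{A}\rightarrow\mathfrak{A}^{0}$, is a higher derivation and $\{\chi_n\}_{n\in\mathbb{N}}$ is a sequence of $\mathcal{R}$-linear mappings $\chi_n:\mathfrak{A}\rightarrow\mathcal{Z}(\mathfrak{A}^{0})$ such that $\chi_n([x,y])=0$ for all $x,y\in\mathfrak{A}$ and each $n\in\mathbb{N}$.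
   Context: $\mathbb{N}$ denotes the set of nonnegative integers. $[x,y]=xy-yx$ is the commutator, and $\mathcal{Z}(\cdot)$ denotes the center of an algebra. Triangular algebra: let $\mathcal{A}$ and $\mathcal{B}$ be unital (associative) algebras over $\mathcal{R}$ and let $\mathcal{M}$ be an $(\mathcal{A},\mathcal{B})$-bimodule which is faithful as a left $\mathcal{A}$-module and also faithful as a right $\mathcal{B}$-module. The triangular algebra $\mathrm{Tri}(\mathcal{A},\mathcal{M},\mathcal{B})$ is the $\mathcal{R}$-algebra of all matrices $\begin{bmatrix} a & m\\ 0 & b\end{bmatrix}$ with $a\in\mathcal{A}$, $m\in\mathcal{M}$, $b\in\mathcal{B}$, under the usual matrix operations. Lie higher derivation on $\mathfrak{A}$: a family $\{L_n\}_{n\in\mathbb{N}}$ of $\mathcal{R}$-linear mappings $L_n:\mathfrak{A}\to\mathfrak{A}$ with $L_0=\mathrm{id}_{\mathfrak{A}}$ and $L_n([x,y])=\sum_{i+j=n}[L_i(x),L_j(y)]$ for all $x,y\in\mathfrak{A}$ and $n\in\mathbb{N}$. Higher derivation from a subalgebra $\mathfrak{A}$ of $\mathfrak{A}^0$ into $\mathfrak{A}^0$: a family $\{\Delta_n\}_{n\in\mathbb{N}}$ of $\mathcal{R}$-linear mappings $\Delta_n:\mathfrak{A}\to\mathfrak{A}^0$ such that $\Delta_0$ is the identity (i.e. the inclusion $\mathfrak{A}\hookrightarrow\mathfrak{A}^0$) and $\Delta_n(xy)=\sum_{i+j=n}\Delta_i(x)\Delta_j(y)$ (products in $\mathfrak{A}^0$)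 for all $x,y\in\mathfrak{A}$ and $n\in\mathbb{N}$. *)

theory Defs
  imports "HOL-Algebra.Module"
begin

text \<open>
  The locale \<open>algebra\<close> of \<open>HOL-Algebra\<close> demands commutative multiplication, so unital associative
  algebras are introduced here on top of \<^locale>\<open>module\<close> and \<^locale>\<open>ring\<close>.
\<close>

locale assoc_algebra = module R A + ring A
  for R :: "('r, 'k) ring_scheme" and A :: "('r, 'a, 'x) module_scheme" +
  assumes smult_mult_left:
      "\<lbrakk>c \<in> carrier R; x \<in> carrier A; y \<in> carrier A\<rbrakk> \<Longrightarrow>
       c \<odot>\<^bsub>A\<^esub> (x \<otimes>\<^bsub>A\<^esub> y) = (c \<odot>\<^bsub>A\<^esub> x) \<otimes>\<^bsub>A\<^esub> y"
    and smult_mult_right: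
      "\<lbrakk>c \<in> carrier R; x \<in> carrier A; y \<in> carrier A\<rbrakk> \<Longrightarrow>
       c \<odot>\<^bsub>A\<^esub> (x \<otimes>\<^bsub>A\<^esub> y) = x \<otimes>\<^bsub>A\<^esub> (c \<odot>\<^bsub>A\<^esub> y)"

text \<open>
  The fields \<open>mult\<close> and \<open>one\<close> of the record \<open>M\<close> play no role.  As usual for bimodules over
  \<open>R\<close>-algebras, \<open>R\<close> acts on \<open>M\<close> compatibly with its actions on \<open>A\<close> and \<open>B\<close>; this is what makes
  the matrices below an \<open>R\<close>-algebra.
\<close>

locale bimodule =
  A: assoc_algebra R A + B: assoc_algebra R B + M: module R M
  for R :: "('r, 'k) ring_scheme" and A :: "('r, 'a, 'x) module_scheme"
    and M :: "('r, 'm, 'y) module_scheme" and B :: "('r, 'b, 'z) module_scheme"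
    and lact :: "'a \<Rightarrow> 'm \<Rightarrow> 'm" and ract :: "'m \<Rightarrow> 'b \<Rightarrow> 'm" +
  assumes lact_closed: "\<lbrakk>a \<in> carrier A; m \<in> carrier M\<rbrakk> \<Longrightarrow> lact a m \<in> carrier M"
    and lact_add_left: "\<lbrakk>a \<in> carrier A; a' \<in> carrier A; m \<in> carrier M\<rbrakk> \<Longrightarrow>
      lact (a \<oplus>\<^bsub>A\<^esub> a') m = lact a m \<oplus>\<^bsub>M\<^esub> lact a' m"
    and lact_add_right: "\<lbrakk>a \<in> carrier A; m \<in> carrier M; m' \<in> carrier M\<rbrakk> \<Longrightarrow>
      lact a (m \<oplus>\<^bsub>M\<^esub> m') = lact a m \<oplus>\<^bsub>M\<^esub> lact a m'"
    and lact_mult: "\<lbrakk>a \<in> carrier A; a' \<in> carrier A; m \<in> carrier M\<rbrakk> \<Longrightarrow>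
      lact (a \<otimes>\<^bsub>A\<^esub> a') m = lact a (lact a' m)"
    and lact_one: "m \<in> carrier M \<Longrightarrow> lact \<one>\<^bsub>A\<^esub> m = m"
    and ract_closed: "\<lbrakk>m \<in> carrier M; b \<in> carrier B\<rbrakk> \<Longrightarrow> ract m b \<in> carrier M"
    and ract_add_left: "\<lbrakk>m \<in> carrier M; m' \<in> carrier M; b \<in> carrier B\<rbrakk> \<Longrightarrow>
      ract (m \<oplus>\<^bsub>M\<^esub> m') b = ract m b \<oplus>\<^bsub>M\<^esub> ract m' b"
    and ract_add_right: "\<lbrakk>m \<in> carrier M; b \<in> carrier B; b' \<in> carrier B\<rbrakk> \<Longrightarrow>
      ract m (b \<oplus>\<^bsub>B\<^esub> b') = ract m b \<oplus>\<^bsub>M\<^esub> ract m b'"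
    and ract_mult: "\<lbrakk>m \<in> carrier M; b \<in> carrier B; b' \<in> carrier B\<rbrakk> \<Longrightarrow>
      ract m (b \<otimes>\<^bsub>B\<^esub> b') = ract (ract m b) b'"
    and ract_one: "m \<in> carrier M \<Longrightarrow> ract m \<one>\<^bsub>B\<^esub> = m"
    and lact_ract: "\<lbrakk>a \<in> carrier A; m \<in> carrier M; b \<in> carrier B\<rbrakk> \<Longrightarrow>
      ract (lact a m) b = lact a (ract m b)"
    and smult_lact_left: "\<lbrakk>c \<in> carrier R; a \<in> carrier A; m \<in> carrier M\<rbrakk> \<Longrightarrow>
      c \<odot>\<^bsub>M\<^esub> lact a m = lact (c \<odot>\<^bsub>A\<^esub> a) m"
    and smult_lact_right: "\<lbrakk>c \<in> carrier R; a \<in> carrier A; m \<in> carrier M\<rbrakk> \<Longrightarrow>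
      c \<odot>\<^bsub>M\<^esub> lact a m = lact a (c \<odot>\<^bsub>M\<^esub> m)"
    and smult_ract_left: "\<lbrakk>c \<in> carrier R; m \<in> carrier M; b \<in> carrier B\<rbrakk> \<Longrightarrow>
      c \<odot>\<^bsub>M\<^esub> ract m b = ract (c \<odot>\<^bsub>M\<^esub> m) b"
    and smult_ract_right: "\<lbrakk>c \<in> carrier R; m \<in> carrier M; b \<in> carrier B\<rbrakk> \<Longrightarrow>
      c \<odot>\<^bsub>M\<^esub> ract m b = ract m (c \<odot>\<^bsub>B\<^esub> b)"

locale triangular = bimodule +
  assumes faithful_left:
      "\<lbrakk>a \<in> carrier A; \<And>m. m \<in> carrier M \<Longrightarrow> lact a m = \<zero>\<^bsub>M\<^esub>\<rbrakk> \<Longrightarrow> a = \<zero>\<^bsub>A\<^esub>"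
    and faithful_right:
      "\<lbrakk>b \<in> carrier B; \<And>m. m \<in> carrier M \<Longrightarrow> ract m b = \<zero>\<^bsub>M\<^esub>\<rbrakk> \<Longrightarrow> b = \<zero>\<^bsub>B\<^esub>"

text \<open>The triple \<open>(a, m, b)\<close> stands for the matrix with rows \<open>a m\<close> and \<open>0 b\<close>.\<close>

definition Tri ::
  "('r, 'a, 'x) module_scheme \<Rightarrow> ('r, 'm, 'y) module_scheme \<Rightarrow> ('r, 'b, 'z) module_scheme \<Rightarrow>
   ('a \<Rightarrow> 'm \<Rightarrow> 'm) \<Rightarrow> ('m \<Rightarrow> 'b \<Rightarrow> 'm) \<Rightarrow> ('r, 'a \<times> 'm \<times> 'b) module" where
  "Tri A M B lact ract =
     \<lparr>carrier = carrier A \<times> carrier M \<times> carrier B,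
      mult = (\<lambda>(a, m, b) (a', m', b').
                (a \<otimes>\<^bsub>A\<^esub> a', lact a m' \<oplus>\<^bsub>M\<^esub> ract m b', b \<otimes>\<^bsub>B\<^esub> b')),
      one = (\<one>\<^bsub>A\<^esub>, \<zero>\<^bsub>M\<^esub>, \<one>\<^bsub>B\<^esub>),
      zero = (\<zero>\<^bsub>A\<^esub>, \<zero>\<^bsub>M\<^esub>, \<zero>\<^bsub>B\<^esub>),
      add = (\<lambda>(a, m, b) (a', m', b'). (a \<oplus>\<^bsub>A\<^esub> a', m \<oplus>\<^bsub>M\<^esub> m', b \<oplus>\<^bsub>B\<^esub> b')),
      smult = (\<lambda>c (a, m, b). (c \<odot>\<^bsub>A\<^esub> a, c \<odot>\<^bsub>M\<^esub> m, c \<odot>\<^bsub>B\<^esub> b))\<rparr>"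

definition commutator :: "('a, 'k) ring_scheme \<Rightarrow> 'a \<Rightarrow> 'a \<Rightarrow> 'a" where
  "commutator T x y = (x \<otimes>\<^bsub>T\<^esub> y) \<ominus>\<^bsub>T\<^esub> (y \<otimes>\<^bsub>T\<^esub> x)"

definition center :: "('a, 'k) ring_scheme \<Rightarrow> 'a set" where
  "center T = {z \<in> carrier T. \<forall>x \<in> carrier T. z \<otimes>\<^bsub>T\<^esub> x = x \<otimes>\<^bsub>T\<^esub> z}"

definition linear_maps ::
  "('r, 'k) ring_scheme \<Rightarrow> ('r, 'v, 'x) module_scheme \<Rightarrow> ('r, 'w, 'y) module_scheme \<Rightarrow>
   ('v \<Rightarrow> 'w) set" where
  "linear_maps R V W = {f \<in> carrier V \<rightarrow> carrier W.
     (\<forall>x \<in> carrier V. \<forall>y \<in> carrier V. f (x \<oplus>\<^bsub>V\<^esub> y) = f x \<oplus>\<^bsub>W\<^esub> f y) \<and>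
     (\<forall>c \<in> carrier R. \<forall>x \<in> carrier V. f (c \<odot>\<^bsub>V\<^esub> x) = c \<odot>\<^bsub>W\<^esub> f x)}"

definition lie_higher_derivation ::
  "('r, 'k) ring_scheme \<Rightarrow> ('r, 'a, 'x) module_scheme \<Rightarrow> (nat \<Rightarrow> 'a \<Rightarrow> 'a) \<Rightarrow> bool" where
  "lie_higher_derivation R T L \<longleftrightarrow>
     (\<forall>n. L n \<in> linear_maps R T T) \<and>
     (\<forall>x \<in> carrier T. L 0 x = x) \<and>
     (\<forall>n. \<forall>x \<in> carrier T. \<forall>y \<in> carrier T.
        L n (commutator T x y) =
          (\<Oplus>\<^bsub>T\<^esub>i \<in> {..n}. commutator T (L i x) (L (n - i) y)))"

text \<open>
  An algebra \<open>T\<close> is regarded as a subalgebra of \<open>T0\<close> with the same identity by means of an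
  injective homomorphism \<open>\<iota>\<close> of unital algebras (\<^const>\<open>ring_hom\<close> preserves the identity).
\<close>

definition algebra_embedding ::
  "('r, 'k) ring_scheme \<Rightarrow> ('r, 'a, 'x) module_scheme \<Rightarrow> ('r, 'c, 'y) module_scheme \<Rightarrow>
   ('a \<Rightarrow> 'c) \<Rightarrow> bool" where
  "algebra_embedding R T T0 \<iota> \<longleftrightarrow>
     \<iota> \<in> ring_hom T T0 \<and> \<iota> \<in> linear_maps R T T0 \<and> inj_on \<iota> (carrier T)"

definition higher_derivation_into ::
  "('r, 'k) ring_scheme \<Rightarrow> ('r, 'a, 'x) module_scheme \<Rightarrow> ('r, 'c, 'y) module_scheme \<Rightarrow>
   ('a \<Rightarrow> 'c) \<Rightarrow> (nat \<Rightarrow> 'a \<Rightarrow> 'c) \<Rightarrow> bool" where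
  "higher_derivation_into R T T0 \<iota> \<Delta> \<longleftrightarrow>
     (\<forall>n. \<Delta> n \<in> linear_maps R T T0) \<and>
     (\<forall>x \<in> carrier T. \<Delta> 0 x = \<iota> x) \<and>
     (\<forall>n. \<forall>x \<in> carrier T. \<forall>y \<in> carrier T.
        \<Delta> n (x \<otimes>\<^bsub>T\<^esub> y) = (\<Oplus>\<^bsub>T0\<^esub>i \<in> {..n}. \<Delta> i x \<otimes>\<^bsub>T0\<^esub> \<Delta> (n - i) y))"

end

theory Submission
  imports Defs
begin

text \<open>
  Read a Lie higher derivation \<open>L\<close> as one formal power series \<open>\<Sigma> L\<^sub>n t\<^sup>n\<close> that preserves
  commutators and starts with the identity.  Let \<open>pA\<close>, \<open>pM\<close>, \<open>pB\<close> be its matrix entries, and for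
  \<open>x\<close> in the triangular algebra let \<open>D x\<close> be the series of operators \<open>m \<mapsto> pA(x) m - m pB(x)\<close> on
  \<open>M\<close>.  All products of series below are Cauchy products.  The upper right entry of the Lie
  identity becomes a cocycle condition,

    \<open>pM [x, y] = D(x) pM(y) - D(y) pM(x)\<close>.

  The idempotent \<open>e = diag(1, 0)\<close> does most of the work.  It commutes with the diagonal, and
  \<open>[e, m] = m\<close> for \<open>m\<close> in \<open>M\<close>.  As \<open>L 0\<close> is the identity, comparing coefficients inductively in
  \<open>[e, a] = 0\<close>, \<open>[e, b] = 0\<close> and \<open>[a, b] = 0\<close> shows that the diagonal entries of all \<open>L n e\<close>, the
  lower entries \<open>pB n a\<close> and the upper entries \<open>pA n b\<close> are central in \<open>A\<close> or \<open>B\<close>.  Then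
  \<open>L m = L [e, m]\<close> has vanishing diagonal entries, so \<open>L\<close> restricts to a series \<open>\<theta>\<close> on \<open>M\<close>, which
  is invertible because it starts with the identity.

  With one argument in \<open>M\<close>, where \<open>D\<close> vanishes, the cocycle identity says
  \<open>\<theta>(a m) = P(a) \<theta>(m)\<close> and \<open>\<theta>(m b) = Q(b) \<theta>(m)\<close> with
  \<open>P(a) = D(a)\<close> and \<open>Q(b) = -D(b)\<close>.  So \<open>P(a)\<close> and \<open>Q(b)\<close> are the conjugates by \<open>\<theta>\<close> of the two
  module actions; in particular \<open>P\<close> is multiplicative, \<open>Q\<close> reverses products, and \<open>D(e) = 1\<close>.
  Putting \<open>x = e\<close> in the cocycle identity gives \<open>pM(a) = P(a) \<mu>\<close> and \<open>pM(b) = -Q(b) \<mu>\<close> with \<open>\<mu> = pM(e)\<close>,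
  the effect of conjugating by the unipotent matrix with upper right entry \<open>\<mu>\<close>.  These formulas make
  \<open>\<Delta>(a, m, b) = (P(a), pM(a, m, b), Q(b))\<close> multiplicative, and \<open>L - \<Delta>\<close> is \<open>diag(z, z)\<close>, where
  \<open>z\<close> is the sum of the right action of the central entry \<open>pB(a)\<close> and the left action of the
  central entry \<open>pA(b)\<close>.

  The operator \<open>P(a)\<close> involves the right action of elements of the centre of \<open>B\<close>, and \<open>Q(b)\<close> the
  left action of elements of the centre of \<open>A\<close>, which is why \<open>\<Delta>\<close> and \<open>\<chi>\<close> need a larger triangular
  algebra.  Its upper corner \<open>A0\<close> is the commutant, among the linear operators on \<open>M\<close>, of the
  action of \<open>B\<close> and of the centre of \<open>A\<close>, and its lower corner is the commutant \<open>B0\<close> of \<open>A0\<close> with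
  reversed multiplication.  The corners act faithfully because they consist of operators, and
  \<open>diag(z, z)\<close> is central as soon as \<open>z\<close> lies in both \<open>A0\<close> and \<open>B0\<close>.
\<close>

section \<open>Additive maps and finite sums in abelian groups\<close>

lemma additive_zero:
  assumes "abelian_group G" "abelian_group H"
    and f: "f \<in> carrier G \<rightarrow> carrier H"
    and add: "\<And>x y. \<lbrakk>x \<in> carrier G; y \<in> carrier G\<rbrakk> \<Longrightarrow> f (x \<oplus>\<^bsub>G\<^esub> y) = f x \<oplus>\<^bsub>H\<^esub> f y"
  shows "f \<zero>\<^bsub>G\<^esub> = \<zero>\<^bsub>H\<^esub>"
proof -
  interpret G: abelian_group G by fact
  interpret H: abelian_group H by fact
  have "f \<zero>\<^bsub>G\<^esub> \<oplus>\<^bsub>H\<^esub> f \<zero>\<^bsub>G\<^esub> = f \<zero>\<^bsub>G\<^esub>"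
    using add[of "\<zero>\<^bsub>G\<^esub>" "\<zero>\<^bsub>G\<^esub>"] by simp
  then show ?thesis
    using f by (metis G.zero_closed H.add.r_cancel_one' PiE)
qed

lemma additive_uminus:
  assumes "abelian_group G" "abelian_group H"
    and f: "f \<in> carrier G \<rightarrow> carrier H"
    and add: "\<And>x y. \<lbrakk>x \<in> carrier G; y \<in> carrier G\<rbrakk> \<Longrightarrow> f (x \<oplus>\<^bsub>G\<^esub> y) = f x \<oplus>\<^bsub>H\<^esub> f y"
    and x: "x \<in> carrier G"
  shows "f (\<ominus>\<^bsub>G\<^esub> x) = \<ominus>\<^bsub>H\<^esub> f x"
proof -
  interpret G: abelian_group G by fact
  interpret H: abelian_group H by fact
  have "f (\<ominus>\<^bsub>G\<^esub> x) \<oplus>\<^bsub>H\<^esub> f x = \<zero>\<^bsub>H\<^esub>"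
    using add[of "\<ominus>\<^bsub>G\<^esub> x" x] additive_zero[OF assms(1-4)] x by (simp add: G.l_neg)
  then show ?thesis
    using f x by (intro H.minus_equality[symmetric]) auto
qed

lemma additive_minus:
  assumes "abelian_group G" "abelian_group H"
    and f: "f \<in> carrier G \<rightarrow> carrier H"
    and add: "\<And>x y. \<lbrakk>x \<in> carrier G; y \<in> carrier G\<rbrakk> \<Longrightarrow> f (x \<oplus>\<^bsub>G\<^esub> y) = f x \<oplus>\<^bsub>H\<^esub> f y"
    and "x \<in> carrier G" "y \<in> carrier G"
  shows "f (x \<ominus>\<^bsub>G\<^esub> y) = f x \<ominus>\<^bsub>H\<^esub> f y"
  using additive_uminus[OF assms(1-4), of y] assms
  by (simp add: a_minus_def add abelian_group.a_inv_closed)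

lemma additive_finsum:
  assumes "abelian_group G" "abelian_group H" "finite S"
    and f: "f \<in> carrier G \<rightarrow> carrier H"
    and add: "\<And>x y. \<lbrakk>x \<in> carrier G; y \<in> carrier G\<rbrakk> \<Longrightarrow> f (x \<oplus>\<^bsub>G\<^esub> y) = f x \<oplus>\<^bsub>H\<^esub> f y"
    and g: "g \<in> S \<rightarrow> carrier G"
  shows "f (finsum G g S) = finsum H (\<lambda>i. f (g i)) S"
proof -
  interpret G: abelian_group G by fact
  interpret H: abelian_group H by fact
  have f0: "f \<zero>\<^bsub>G\<^esub> = \<zero>\<^bsub>H\<^esub>"
    using assms(1,2) f add by (rule additive_zero)
  from \<open>finite S\<close> g show ?thesis
  proof (induction S rule: finite_induct)
    case empty
    then show ?case by (simp add: f0)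
  next
    case (insert s S)
    then have "g s \<in> carrier G" "g \<in> S \<rightarrow> carrier G" by auto
    moreover from this f have "f (g s) \<in> carrier H" "(\<lambda>i. f (g i)) \<in> S \<rightarrow> carrier H" by auto
    ultimately show ?case
      using insert by (simp add: add)
  qed
qed

lemma (in abelian_group) finsum_minus:
  assumes "finite S" "f \<in> S \<rightarrow> carrier G" "g \<in> S \<rightarrow> carrier G"
  shows "(\<Oplus>i\<in>S. f i \<ominus> g i) = (\<Oplus>i\<in>S. f i) \<ominus> (\<Oplus>i\<in>S. g i)"
proof -
  have "(\<Oplus>i\<in>S. f i \<ominus> g i) = (\<Oplus>i\<in>S. f i) \<oplus> (\<Oplus>i\<in>S. \<ominus> g i)"
    unfolding a_minus_def using assms by (intro finsum_addf) auto
  also have "(\<Oplus>i\<in>S. \<ominus> g i) = \<ominus> (\<Oplus>i\<in>S. g i)"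
    by (rule additive_finsum[symmetric, OF abelian_group_axioms abelian_group_axioms])
      (use assms in \<open>auto simp: minus_add\<close>)
  finally show ?thesis by (simp add: a_minus_def)
qed

lemma (in abelian_monoid) finsum_rev:
  fixes f :: "nat \<Rightarrow> 'a"
  assumes "f \<in> {..n} \<rightarrow> carrier G"
  shows "(\<Oplus>i\<in>{..n}. f (n - i)) = (\<Oplus>i\<in>{..n}. f i)"
proof -
  have inj: "inj_on (\<lambda>i. n - i) {..n}" by (auto intro: inj_onI)
  have "x \<in> (\<lambda>i. n - i) ` {..n}" if "x \<le> n" for x
    using that by (intro image_eqI[of _ _ "n - x"]) auto
  then have "(\<lambda>i. n - i) ` {..n} = {..n}"
    by auto
  with finsum_reindex[OF _ inj, of f] assms show ?thesis by simp
qed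

text \<open>The summation order behind the associativity of Cauchy products.\<close>

lemma (in abelian_monoid) finsum_triangle:
  fixes f :: "nat \<Rightarrow> nat \<Rightarrow> 'a"
  assumes f: "\<And>i j. f i j \<in> carrier G"
  shows "(\<Oplus>i\<in>{..n}. \<Oplus>j\<in>{..n - i}. f i j) = (\<Oplus>k\<in>{..n}. \<Oplus>i\<in>{..k}. f i (k - i))"
proof (induction n)
  case 0
  show ?case by (simp add: f)
next
  case (Suc n)
  have "(\<Oplus>i\<in>{..Suc n}. \<Oplus>j\<in>{..Suc n - i}. f i j)
      = f (Suc n) 0 \<oplus> (\<Oplus>i\<in>{..n}. \<Oplus>j\<in>{..Suc n - i}. f i j)"
    by (simp add: f)
  also have "(\<Oplus>i\<in>{..n}. \<Oplus>j\<in>{..Suc n - i}. f i j)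
      = (\<Oplus>i\<in>{..n}. f i (Suc n - i) \<oplus> (\<Oplus>j\<in>{..n - i}. f i j))"
    by (rule finsum_cong') (auto simp: f Suc_diff_le)
  also have "\<dots> = (\<Oplus>i\<in>{..n}. f i (Suc n - i)) \<oplus> (\<Oplus>i\<in>{..n}. \<Oplus>j\<in>{..n - i}. f i j)"
    by (rule finsum_addf) (auto simp: f)
  also have "f (Suc n) 0 \<oplus> \<dots> = (\<Oplus>i\<in>{..Suc n}. f i (Suc n - i)) \<oplus> (\<Oplus>i\<in>{..n}. \<Oplus>j\<in>{..n - i}. f i j)"
    by (simp add: f a_assoc)
  also have "\<dots> = (\<Oplus>k\<in>{..Suc n}. \<Oplus>i\<in>{..k}. f i (k - i))"
    unfolding Suc.IH by (simp add: f)
  finally show ?case .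
qed

lemma (in abelian_monoid) finsum_atMost_last:
  fixes f :: "nat \<Rightarrow> 'a"
  assumes "f \<in> {..n} \<rightarrow> carrier G"
  shows "(\<Oplus>i\<in>{..n}. f i) = f n \<oplus> (\<Oplus>i\<in>{..<n}. f i)"
proof -
  have "{..n} = insert n {..<n}" by auto
  with assms show ?thesis by (simp add: Pi_iff)
qed

text \<open>
  Rearranges the upper right entry of a commutator of triangular matrices into a difference of two
  values of operators of the form \<open>m \<mapsto> a m - m b\<close>.
\<close>

lemma (in abelian_group) minus_regroup:
  assumes "p \<in> carrier G" "q \<in> carrier G" "r \<in> carrier G" "s \<in> carrier G"
  shows "(p \<oplus> q) \<ominus> (r \<oplus> s) = (p \<ominus> s) \<ominus> (r \<ominus> q)"
  using assms by (simp add: a_minus_def minus_add a_ac)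

lemma (in abelian_group) minus_self: "x \<in> carrier G \<Longrightarrow> x \<ominus> x = \<zero>"
  by (simp add: a_minus_def r_neg)

lemma (in abelian_group) minus_zero_right: "x \<in> carrier G \<Longrightarrow> x \<ominus> \<zero> = x"
  by (simp add: a_minus_def)

lemma (in abelian_group) eq_if_minus_eq_zero:
  assumes "x \<in> carrier G" "y \<in> carrier G" "x \<ominus> y = \<zero>"
  shows "x = y"
  using assms add.inv_solve_right'[of \<zero> x y] by (simp add: a_minus_def)

lemma (in abelian_group) add_diff_telescope:
  assumes "t \<in> carrier G" "u \<in> carrier G" "p \<in> carrier G" "c \<in> carrier G" "q \<in> carrier G"
  shows "(t \<oplus> (p \<ominus> c)) \<oplus> (u \<oplus> (c \<ominus> q)) = (t \<oplus> u) \<oplus> (p \<ominus> q)"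
proof -
  have "(p \<oplus> \<ominus> c) \<oplus> (c \<oplus> \<ominus> q) = p \<oplus> \<ominus> q"
    using assms by (metis a_assoc a_inv_closed add.m_closed l_neg l_zero)
  then have "(t \<oplus> u) \<oplus> ((p \<oplus> \<ominus> c) \<oplus> (c \<oplus> \<ominus> q)) = (t \<oplus> u) \<oplus> (p \<oplus> \<ominus> q)"
    by simp
  with assms show ?thesis
    by (simp add: a_minus_def a_ac)
qed

section \<open>The triangular algebra as a module\<close>

lemma linear_mapsI:
  assumes "\<And>x. x \<in> carrier V \<Longrightarrow> f x \<in> carrier W"
    and "\<And>x y. \<lbrakk>x \<in> carrier V; y \<in> carrier V\<rbrakk> \<Longrightarrow> f (x \<oplus>\<^bsub>V\<^esub> y) = f x \<oplus>\<^bsub>W\<^esub> f y"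
    and "\<And>c x. \<lbrakk>c \<in> carrier R; x \<in> carrier V\<rbrakk> \<Longrightarrow> f (c \<odot>\<^bsub>V\<^esub> x) = c \<odot>\<^bsub>W\<^esub> f x"
  shows "f \<in> linear_maps R V W"
  using assms by (auto simp: linear_maps_def)

lemma
  assumes "f \<in> linear_maps R V W"
  shows linear_maps_closed: "x \<in> carrier V \<Longrightarrow> f x \<in> carrier W"
    and linear_maps_add: "\<lbrakk>x \<in> carrier V; y \<in> carrier V\<rbrakk> \<Longrightarrow> f (x \<oplus>\<^bsub>V\<^esub> y) = f x \<oplus>\<^bsub>W\<^esub> f y"
    and linear_maps_smult: "\<lbrakk>c \<in> carrier R; x \<in> carrier V\<rbrakk> \<Longrightarrow> f (c \<odot>\<^bsub>V\<^esub> x) = c \<odot>\<^bsub>W\<^esub> f x"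
  using assms by (auto simp: linear_maps_def)

lemma Tri_simps [simp]:
  "carrier (Tri A M B l r) = carrier A \<times> carrier M \<times> carrier B"
  "\<one>\<^bsub>Tri A M B l r\<^esub> = (\<one>\<^bsub>A\<^esub>, \<zero>\<^bsub>M\<^esub>, \<one>\<^bsub>B\<^esub>)"
  "\<zero>\<^bsub>Tri A M B l r\<^esub> = (\<zero>\<^bsub>A\<^esub>, \<zero>\<^bsub>M\<^esub>, \<zero>\<^bsub>B\<^esub>)"
  "(a, m, b) \<otimes>\<^bsub>Tri A M B l r\<^esub> (a', m', b') =
     (a \<otimes>\<^bsub>A\<^esub> a', l a m' \<oplus>\<^bsub>M\<^esub> r m b', b \<otimes>\<^bsub>B\<^esub> b')"
  "(a, m, b) \<oplus>\<^bsub>Tri A M B l r\<^esub> (a', m', b') = (a \<oplus>\<^bsub>A\<^esub> a', m \<oplus>\<^bsub>M\<^esub> m', b \<oplus>\<^bsub>B\<^esub> b')"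
  "c \<odot>\<^bsub>Tri A M B l r\<^esub> (a, m, b) = (c \<odot>\<^bsub>A\<^esub> a, c \<odot>\<^bsub>M\<^esub> m, c \<odot>\<^bsub>B\<^esub> b)"
  by (simp_all add: Tri_def)

context bimodule
begin

abbreviation "T \<equiv> Tri A M B lact ract"

lemma Tri_abelian_group: "abelian_group T"
proof (rule abelian_groupI, goal_cases)
  case (6 x)
  then obtain a m b where x: "x = (a, m, b)" "a \<in> carrier A" "m \<in> carrier M" "b \<in> carrier B"
    by auto
  then show ?case
    by (intro bexI[of _ "(\<ominus>\<^bsub>A\<^esub> a, \<ominus>\<^bsub>M\<^esub> m, \<ominus>\<^bsub>B\<^esub> b)"])
      (simp_all add: A.l_neg M.l_neg B.l_neg)
qed (auto simp: A.a_ac M.a_ac B.a_ac)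

lemma Tri_minus:
  assumes "a \<in> carrier A" "a' \<in> carrier A" "m \<in> carrier M" "m' \<in> carrier M"
    "b \<in> carrier B" "b' \<in> carrier B"
  shows "(a, m, b) \<ominus>\<^bsub>T\<^esub> (a', m', b') = (a \<ominus>\<^bsub>A\<^esub> a', m \<ominus>\<^bsub>M\<^esub> m', b \<ominus>\<^bsub>B\<^esub> b')"
proof -
  interpret T: abelian_group T by (rule Tri_abelian_group)
  have "\<ominus>\<^bsub>T\<^esub> (a', m', b') = (\<ominus>\<^bsub>A\<^esub> a', \<ominus>\<^bsub>M\<^esub> m', \<ominus>\<^bsub>B\<^esub> b')"
    by (rule T.minus_equality) (use assms in \<open>simp_all add: A.l_neg M.l_neg B.l_neg\<close>)
  then show ?thesis by (simp add: a_minus_def)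
qed

lemma Tri_commutator:
  assumes "a \<in> carrier A" "a' \<in> carrier A" "m \<in> carrier M" "m' \<in> carrier M"
    "b \<in> carrier B" "b' \<in> carrier B"
  shows "commutator T (a, m, b) (a', m', b') =
    (commutator A a a',
     (lact a m' \<oplus>\<^bsub>M\<^esub> ract m b') \<ominus>\<^bsub>M\<^esub> (lact a' m \<oplus>\<^bsub>M\<^esub> ract m' b),
     commutator B b b')"
  using assms by (simp add: commutator_def Tri_minus lact_closed ract_closed)

lemma Tri_finsum:
  assumes "finite S" "f \<in> S \<rightarrow> carrier A" "g \<in> S \<rightarrow> carrier M" "h \<in> S \<rightarrow> carrier B"
  shows "finsum T (\<lambda>i. (f i, g i, h i)) S = (finsum A f S, finsum M g S, finsum B h S)"
proof -
  interpret T: abelian_group T by (rule Tri_abelian_group)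
  from assms show ?thesis
    by (induction S rule: finite_induct) (auto simp: Pi_iff)
qed

lemma lact_zero_right: "a \<in> carrier A \<Longrightarrow> lact a \<zero>\<^bsub>M\<^esub> = \<zero>\<^bsub>M\<^esub>"
  by (rule additive_zero[OF M.abelian_group_axioms M.abelian_group_axioms])
    (auto simp: lact_closed lact_add_right)

lemma ract_zero_left: "b \<in> carrier B \<Longrightarrow> ract \<zero>\<^bsub>M\<^esub> b = \<zero>\<^bsub>M\<^esub>"
  by (rule additive_zero[OF M.abelian_group_axioms M.abelian_group_axioms])
    (auto simp: ract_closed ract_add_left)

lemma lact_zero_left: "m \<in> carrier M \<Longrightarrow> lact \<zero>\<^bsub>A\<^esub> m = \<zero>\<^bsub>M\<^esub>"
  by (rule additive_zero[OF A.is_abelian_group M.abelian_group_axioms, of "\<lambda>a. lact a m"])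
    (auto simp: lact_closed lact_add_left)

lemma ract_zero_right: "m \<in> carrier M \<Longrightarrow> ract m \<zero>\<^bsub>B\<^esub> = \<zero>\<^bsub>M\<^esub>"
  by (rule additive_zero[OF B.is_abelian_group M.abelian_group_axioms])
    (auto simp: ract_closed ract_add_right)

end

section \<open>Commutants as algebras of operators\<close>

text \<open>
  Operators are made extensional so that two of them are equal as soon as they agree on the
  carrier; without this the action of an operator algebra would not be faithful.
\<close>

definition linear_operators :: "('r, 'k) ring_scheme \<Rightarrow> ('r, 'm, 'y) module_scheme \<Rightarrow> ('m \<Rightarrow> 'm) set"
  where "linear_operators R M = linear_maps R M M \<inter> extensional (carrier M)"

definition commutant ::
  "('r, 'k) ring_scheme \<Rightarrow> ('r, 'm, 'y) module_scheme \<Rightarrow> ('m \<Rightarrow> 'm) set \<Rightarrow> ('m \<Rightarrow> 'm) set" where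
  "commutant R M S =
     {f \<in> linear_operators R M. \<forall>s\<in>S. \<forall>m\<in>carrier M. f (s m) = s (f m)}"

definition operator_algebra ::
  "('r, 'm, 'y) module_scheme \<Rightarrow> ('m \<Rightarrow> 'm) set \<Rightarrow> ('r, 'm \<Rightarrow> 'm) module" where
  "operator_algebra M X =
     \<lparr>carrier = X,
      mult = compose (carrier M),
      one = (\<lambda>m\<in>carrier M. m),
      zero = (\<lambda>m\<in>carrier M. \<zero>\<^bsub>M\<^esub>),
      add = (\<lambda>f g. \<lambda>m\<in>carrier M. f m \<oplus>\<^bsub>M\<^esub> g m),
      smult = (\<lambda>c f. \<lambda>m\<in>carrier M. c \<odot>\<^bsub>M\<^esub> f m)\<rparr>"

definition opposite_algebra :: "('r, 'a, 'x) module_scheme \<Rightarrow> ('r, 'a, 'x) module_scheme" where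
  "opposite_algebra A = A\<lparr>mult := \<lambda>x y. y \<otimes>\<^bsub>A\<^esub> x\<rparr>"

lemma operator_algebra_simps [simp]:
  "carrier (operator_algebra M X) = X"
  "f \<otimes>\<^bsub>operator_algebra M X\<^esub> g = (\<lambda>m\<in>carrier M. f (g m))"
  "\<one>\<^bsub>operator_algebra M X\<^esub> = (\<lambda>m\<in>carrier M. m)"
  "\<zero>\<^bsub>operator_algebra M X\<^esub> = (\<lambda>m\<in>carrier M. \<zero>\<^bsub>M\<^esub>)"
  "f \<oplus>\<^bsub>operator_algebra M X\<^esub> g = (\<lambda>m\<in>carrier M. f m \<oplus>\<^bsub>M\<^esub> g m)"
  "c \<odot>\<^bsub>operator_algebra M X\<^esub> f = (\<lambda>m\<in>carrier M. c \<odot>\<^bsub>M\<^esub> f m)"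
  by (simp_all add: operator_algebra_def compose_def)

lemma opposite_algebra_simps [simp]:
  "carrier (opposite_algebra A) = carrier A"
  "x \<otimes>\<^bsub>opposite_algebra A\<^esub> y = y \<otimes>\<^bsub>A\<^esub> x"
  "\<one>\<^bsub>opposite_algebra A\<^esub> = \<one>\<^bsub>A\<^esub>"
  "\<zero>\<^bsub>opposite_algebra A\<^esub> = \<zero>\<^bsub>A\<^esub>"
  "x \<oplus>\<^bsub>opposite_algebra A\<^esub> y = x \<oplus>\<^bsub>A\<^esub> y"
  "c \<odot>\<^bsub>opposite_algebra A\<^esub> x = c \<odot>\<^bsub>A\<^esub> x"
  by (simp_all add: opposite_algebra_def)

lemma opposite_assoc_algebra:
  assumes "assoc_algebra R A"
  shows "assoc_algebra R (opposite_algebra A)"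
proof -
  interpret assoc_algebra R A by fact
  have ag: "abelian_group (opposite_algebra A)"
    by (rule abelian_groupI)
      (auto simp: M.a_ac intro: bexI[of _ "\<ominus>\<^bsub>A\<^esub> _"] M.l_neg)
  have "module R (opposite_algebra A)"
    by (rule moduleI)
      (auto simp: ag R.is_cring smult_l_distr smult_r_distr smult_assoc1)
  moreover have "ring (opposite_algebra A)"
    by (rule ringI[OF ag], unfold_locales) (auto simp: m_assoc l_distr r_distr)
  ultimately show ?thesis
    by (intro assoc_algebra.intro assoc_algebra_axioms.intro)
      (simp_all, metis smult_mult_right, metis smult_mult_left)
qed

context module
begin

lemma linear_operatorsI:
  assumes "\<And>x. x \<in> carrier M \<Longrightarrow> f x \<in> carrier M"
    and "\<And>x y. \<lbrakk>x \<in> carrier M; y \<in> carrier M\<rbrakk> \<Longrightarrow> f (x \<oplus>\<^bsub>M\<^esub> y) = f x \<oplus>\<^bsub>M\<^esub> f y"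
    and "\<And>c x. \<lbrakk>c \<in> carrier R; x \<in> carrier M\<rbrakk> \<Longrightarrow> f (c \<odot>\<^bsub>M\<^esub> x) = c \<odot>\<^bsub>M\<^esub> f x"
  shows "(\<lambda>m\<in>carrier M. f m) \<in> linear_operators R M"
  using assms by (auto simp: linear_operators_def intro!: linear_mapsI)

lemma
  assumes "f \<in> linear_operators R M"
  shows operator_closed: "x \<in> carrier M \<Longrightarrow> f x \<in> carrier M"
    and operator_add: "\<lbrakk>x \<in> carrier M; y \<in> carrier M\<rbrakk> \<Longrightarrow> f (x \<oplus>\<^bsub>M\<^esub> y) = f x \<oplus>\<^bsub>M\<^esub> f y"
    and operator_smult: "\<lbrakk>c \<in> carrier R; x \<in> carrier M\<rbrakk> \<Longrightarrow> f (c \<odot>\<^bsub>M\<^esub> x) = c \<odot>\<^bsub>M\<^esub> f x"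
    and operator_ext: "f \<in> extensional (carrier M)"
    and operator_funcset: "f \<in> carrier M \<rightarrow> carrier M"
  using assms by (auto simp: linear_operators_def linear_maps_def)

lemma operator_minus:
  assumes "f \<in> linear_operators R M" "x \<in> carrier M" "y \<in> carrier M"
  shows "f (x \<ominus>\<^bsub>M\<^esub> y) = f x \<ominus>\<^bsub>M\<^esub> f y"
  using assms by (intro additive_minus[OF M.abelian_group_axioms M.abelian_group_axioms])
     (auto simp: operator_closed operator_add)

lemma operator_uminus:
  assumes "f \<in> linear_operators R M" "x \<in> carrier M"
  shows "f (\<ominus>\<^bsub>M\<^esub> x) = \<ominus>\<^bsub>M\<^esub> f x"
  using assms by (intro additive_uminus[OF M.abelian_group_axioms M.abelian_group_axioms])
     (auto simp: operator_closed operator_add)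

lemma operator_zero:
  assumes "f \<in> linear_operators R M"
  shows "f \<zero>\<^bsub>M\<^esub> = \<zero>\<^bsub>M\<^esub>"
  using assms by (intro additive_zero[OF M.abelian_group_axioms M.abelian_group_axioms])
     (auto simp: operator_closed operator_add)

lemma operator_finsum:
  assumes "f \<in> linear_operators R M" "finite S" "g \<in> S \<rightarrow> carrier M"
  shows "f (finsum M g S) = (\<Oplus>\<^bsub>M\<^esub>i\<in>S. f (g i))"
  using assms by (intro additive_finsum[OF M.abelian_group_axioms M.abelian_group_axioms])
     (auto simp: operator_closed operator_add)

lemma smult_uminus_right:
  assumes "c \<in> carrier R" "x \<in> carrier M"
  shows "c \<odot>\<^bsub>M\<^esub> (\<ominus>\<^bsub>M\<^esub> x) = \<ominus>\<^bsub>M\<^esub> (c \<odot>\<^bsub>M\<^esub> x)"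
  by (rule additive_uminus[OF M.abelian_group_axioms M.abelian_group_axioms])
    (use assms in \<open>auto simp: smult_r_distr\<close>)

lemma smult_commute:
  "\<lbrakk>c \<in> carrier R; d \<in> carrier R; x \<in> carrier M\<rbrakk> \<Longrightarrow>
    c \<odot>\<^bsub>M\<^esub> (d \<odot>\<^bsub>M\<^esub> x) = d \<odot>\<^bsub>M\<^esub> (c \<odot>\<^bsub>M\<^esub> x)"
  by (simp add: smult_assoc1[symmetric] R.m_comm)

text \<open>
  The set \<open>S\<close> has to consist of linear maps: an operator commuting with arbitrary functions need
  not have a sum or a scalar multiple that does.
\<close>

lemma commutant_assoc_algebra:
  assumes S: "S \<subseteq> linear_operators R M"
  shows "assoc_algebra R (operator_algebra M (commutant R M S))" (is "assoc_algebra R ?E")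
proof -
  note ops = operator_closed operator_add operator_smult operator_minus operator_uminus operator_zero
  have C: "f \<in> linear_operators R M" "\<And>s m. \<lbrakk>s \<in> S; m \<in> carrier M\<rbrakk> \<Longrightarrow> f (s m) = s (f m)"
    if "f \<in> commutant R M S" for f
    using that by (auto simp: commutant_def)
  have I: "f \<in> commutant R M S"
    if "f \<in> linear_operators R M" "\<And>s m. \<lbrakk>s \<in> linear_operators R M; s \<in> S; m \<in> carrier M\<rbrakk> \<Longrightarrow> f (s m) = s (f m)"
    for f using that S by (auto simp: commutant_def)
  have add: "(\<lambda>m\<in>carrier M. f m \<oplus>\<^bsub>M\<^esub> g m) \<in> commutant R M S"
    if "f \<in> commutant R M S" "g \<in> commutant R M S" for f g
    using that[THEN C(1)] that[THEN C(2)]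
    by (intro I linear_operatorsI) (auto simp: ops M.a_ac smult_r_distr)
  have smult: "(\<lambda>m\<in>carrier M. c \<odot>\<^bsub>M\<^esub> f m) \<in> commutant R M S"
    if "f \<in> commutant R M S" "c \<in> carrier R" for f c
    using that(2) C[OF that(1)]
    by (intro I linear_operatorsI) (auto simp: ops smult_r_distr smult_commute)
  have mult: "(\<lambda>m\<in>carrier M. f (g m)) \<in> commutant R M S"
    if "f \<in> commutant R M S" "g \<in> commutant R M S" for f g
    using that[THEN C(1)] that[THEN C(2)]
    by (intro I linear_operatorsI) (auto simp: ops)
  have neg: "(\<lambda>m\<in>carrier M. \<ominus>\<^bsub>M\<^esub> f m) \<in> commutant R M S"
    if "f \<in> commutant R M S" for f
    using C[OF that]
    by (intro I linear_operatorsI) (auto simp: ops smult_uminus_right M.minus_add)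
  have zero: "(\<lambda>m\<in>carrier M. \<zero>\<^bsub>M\<^esub>) \<in> commutant R M S"
    by (intro I linear_operatorsI) (auto simp: ops)
  have one: "(\<lambda>m\<in>carrier M. m) \<in> commutant R M S"
    by (intro I linear_operatorsI) (auto simp: ops)
  note closed = add smult mult neg zero one
  have ag: "abelian_group ?E"
  proof (rule abelian_groupI, goal_cases)
    case (6 f)
    then have f: "f \<in> commutant R M S" by simp
    then show ?case
      by (intro bexI[of _ "\<lambda>m\<in>carrier M. \<ominus>\<^bsub>M\<^esub> f m"])
        (auto intro!: extensionalityI[where A = "carrier M"] simp: neg ops C(1) M.l_neg)
  qed (auto intro!: extensionalityI[where A = "carrier M"] simp: closed ops C(1) operator_ext M.a_ac)
  have "module R ?E"
    by (rule moduleI)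
      (auto intro!: ag R.is_cring extensionalityI[where A = "carrier M"]
        simp: closed ops C(1) operator_ext smult_l_distr smult_r_distr smult_assoc1)
  moreover have "ring ?E"
    by (rule ringI[OF ag], unfold_locales)
     (auto intro!: extensionalityI[where A = "carrier M"]
        simp: closed ops C(1) operator_ext)
  ultimately show ?thesis
    by (intro assoc_algebra.intro assoc_algebra_axioms.intro)
      (auto intro!: extensionalityI[where A = "carrier M"]
        simp: closed ops C(1) operator_ext)
qed

text \<open>Evaluation at \<open>m\<close> is additive, so sums of operators may be computed pointwise.\<close>

lemma operator_algebra_finsum:
  assumes "abelian_group (operator_algebra M X)" "X \<subseteq> linear_operators R M"
    "finite S" "f \<in> S \<rightarrow> X" "m \<in> carrier M"
  shows "finsum (operator_algebra M X) f S m = (\<Oplus>\<^bsub>M\<^esub>i\<in>S. f i m)"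
  using assms by (intro additive_finsum[OF assms(1) M.abelian_group_axioms, of _ "\<lambda>f. f m"])
    (auto simp: operator_closed)

lemma minus_operator:
  assumes "f \<in> linear_operators R M" "g \<in> linear_operators R M"
  shows "(\<lambda>m\<in>carrier M. f m \<ominus>\<^bsub>M\<^esub> g m) \<in> linear_operators R M"
  using assms
  by (intro linear_operatorsI)
    (auto simp: operator_closed operator_add operator_smult a_minus_def M.minus_add M.a_ac
      smult_r_distr smult_uminus_right)

end

text \<open>Forgets the additional record fields, which gives the module the type of a plain record.\<close>

definition module_reduct :: "('r, 'm, 'y) module_scheme \<Rightarrow> ('r, 'm) module" where
  "module_reduct M = \<lparr>carrier = carrier M, mult = mult M, one = one M, zero = zero M,
     add = add M, smult = smult M\<rparr>"

lemma module_reduct_simps [simp]: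
  "carrier (module_reduct M) = carrier M"
  "\<zero>\<^bsub>module_reduct M\<^esub> = \<zero>\<^bsub>M\<^esub>"
  "x \<oplus>\<^bsub>module_reduct M\<^esub> y = x \<oplus>\<^bsub>M\<^esub> y"
  "c \<odot>\<^bsub>module_reduct M\<^esub> x = c \<odot>\<^bsub>M\<^esub> x"
  by (simp_all add: module_reduct_def)

lemma finsum_module_reduct: "finsum (module_reduct M) f S = finsum M f S"
  by (simp add: finsum_def finprod_def module_reduct_def)

lemma finsum_opposite_algebra: "finsum (opposite_algebra A) f S = finsum A f S"
  by (simp add: finsum_def opposite_algebra_def)

context module
begin

lemma module_module_reduct: "module R (module_reduct M)"
proof -
  have "abelian_group (module_reduct M)"
    by (rule abelian_groupI)
      (auto simp: M.a_ac intro: bexI[of _ "\<ominus>\<^bsub>M\<^esub> _"] M.l_neg)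
  then show ?thesis
    by (intro moduleI) (auto simp: R.is_cring smult_l_distr smult_r_distr smult_assoc1)
qed

lemma commutant_operators: "commutant R M S \<subseteq> linear_operators R M"
  by (auto simp: commutant_def)

lemma commutantI:
  assumes "f \<in> linear_operators R M" "\<And>s m. \<lbrakk>s \<in> S; m \<in> carrier M\<rbrakk> \<Longrightarrow> f (s m) = s (f m)"
  shows "f \<in> commutant R M S"
  using assms by (auto simp: commutant_def)

lemma commutantD:
  assumes "f \<in> commutant R M S" "s \<in> S" "m \<in> carrier M"
  shows "f (s m) = s (f m)"
  using assms by (auto simp: commutant_def)

lemma subset_bicommutant:
  assumes "S \<subseteq> linear_operators R M"
  shows "S \<subseteq> commutant R M (commutant R M S)"
  using assms by (auto simp: commutant_def)

lemma commutant_add: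
  assumes S: "S \<subseteq> linear_operators R M" and fg: "f \<in> commutant R M S" "g \<in> commutant R M S"
  shows "(\<lambda>m\<in>carrier M. f m \<oplus>\<^bsub>M\<^esub> g m) \<in> commutant R M S"
proof -
  interpret E: assoc_algebra R "operator_algebra M (commutant R M S)"
    by (rule commutant_assoc_algebra[OF S])
  show ?thesis using E.add.m_closed fg by simp
qed

lemma commutant_minus:
  assumes S: "S \<subseteq> linear_operators R M" and fg: "f \<in> commutant R M S" "g \<in> commutant R M S"
  shows "(\<lambda>m\<in>carrier M. f m \<ominus>\<^bsub>M\<^esub> g m) \<in> commutant R M S"
proof -
  interpret E: assoc_algebra R "operator_algebra M (commutant R M S)"
    by (rule commutant_assoc_algebra[OF S])
  note cl = fg[THEN subsetD[OF commutant_operators]]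
  have "(\<ominus>\<^bsub>operator_algebra M (commutant R M S)\<^esub> g) m = \<ominus>\<^bsub>M\<^esub> g m" if "m \<in> carrier M" for m
    using that fg cl commutant_operators[of S]
    by (intro additive_uminus[OF E.abelian_group_axioms M.abelian_group_axioms, of "\<lambda>f. f m"])
      (auto simp: operator_closed)
  then have "(\<lambda>m\<in>carrier M. f m \<ominus>\<^bsub>M\<^esub> g m) = f \<ominus>\<^bsub>operator_algebra M (commutant R M S)\<^esub> g"
    by (auto simp: a_minus_def)
  then show ?thesis using E.minus_closed fg by simp
qed

text \<open>
  The bimodule law says that the two corners commute as operators, which is the definition of the
  second commutant.  The lower corner acts from the right, hence the opposite multiplication.
\<close>

lemma triangular_operator_algebras:
  assumes S: "S \<subseteq> linear_operators R M"
  shows "triangular R (operator_algebra M (commutant R M S)) (module_reduct M)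
    (opposite_algebra (operator_algebra M (commutant R M (commutant R M S))))
    (\<lambda>f m. f m) (\<lambda>m g. g m)"
    (is "triangular R ?A ?M ?B _ _")
proof -
  have A: "assoc_algebra R ?A" by (rule commutant_assoc_algebra[OF S])
  have B: "assoc_algebra R ?B"
    by (rule opposite_assoc_algebra[OF commutant_assoc_algebra[OF commutant_operators]])
  note ops = commutant_operators[THEN subsetD]
  note simps = operator_closed[OF ops] operator_add[OF ops] operator_smult[OF ops]
  show ?thesis
  proof (intro triangular.intro bimodule.intro A B module_module_reduct
      triangular_axioms.intro bimodule_axioms.intro)
    fix f assume "f \<in> carrier ?A" "\<And>m. m \<in> carrier ?M \<Longrightarrow> f m = \<zero>\<^bsub>?M\<^esub>"
    then show "f = \<zero>\<^bsub>?A\<^esub>"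
      by (auto intro!: extensionalityI[where A = "carrier M"] intro: operator_ext[OF ops])
  next
    fix g assume "g \<in> carrier ?B" "\<And>m. m \<in> carrier ?M \<Longrightarrow> g m = \<zero>\<^bsub>?M\<^esub>"
    then show "g = \<zero>\<^bsub>?B\<^esub>"
      by (auto intro!: extensionalityI[where A = "carrier M"] intro: operator_ext[OF ops])
  next
    fix f m g assume "f \<in> carrier ?A" "m \<in> carrier ?M" "g \<in> carrier ?B"
    then show "g (f m) = f (g m)"
      by (intro commutantD[of g]) auto
  qed (auto simp: simps)
qed

text \<open>
  An operator in both corners commutes with both of them: with the first as a member of the second
  commutant, with the second as a member of the first.
\<close>

lemma diagonal_central:
  assumes "z \<in> commutant R M S" "z \<in> commutant R M (commutant R M S)"
  shows "(z, \<zero>\<^bsub>M\<^esub>, z) \<in> center (Tri (operator_algebra M (commutant R M S)) (module_reduct M)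
    (opposite_algebra (operator_algebra M (commutant R M (commutant R M S))))
    (\<lambda>f m. f m) (\<lambda>m g. g m))"
proof -
  note ops = commutant_operators[THEN subsetD]
  note simps = operator_closed[OF ops] operator_zero[OF ops] commutantD[OF assms(2)]
    commutantD[OF _ assms(1)]
  show ?thesis
    using assms by (auto simp: center_def simps)
qed

end

context bimodule
begin

definition "lmul a = (\<lambda>m\<in>carrier M. lact a m)"
definition "rmul b = (\<lambda>m\<in>carrier M. ract m b)"

lemma lmul_operator:
  assumes "a \<in> carrier A"
  shows "lmul a \<in> linear_operators R M"
  unfolding lmul_def
  using assms by (intro M.linear_operatorsI) (auto simp: lact_closed lact_add_right smult_lact_right)

lemma rmul_operator:
  assumes "b \<in> carrier B"
  shows "rmul b \<in> linear_operators R M"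
  unfolding rmul_def
  using assms by (intro M.linear_operatorsI) (auto simp: ract_closed ract_add_left smult_ract_left)

end

section \<open>Operator series\<close>

text \<open>
  The coefficient of \<open>t\<^sup>n\<close> in the product of the operator series \<open>\<Sigma> F\<^sub>i t\<^sup>i\<close> with the series
  \<open>\<Sigma> w\<^sub>j t\<^sup>j\<close> of module elements.
\<close>

definition series_apply ::
  "('r, 'm, 'y) module_scheme \<Rightarrow> (nat \<Rightarrow> 'm \<Rightarrow> 'm) \<Rightarrow> (nat \<Rightarrow> 'm) \<Rightarrow> nat \<Rightarrow> 'm" where
  "series_apply M F w n = (\<Oplus>\<^bsub>M\<^esub>i\<in>{..n}. F i (w (n - i)))"

context module
begin

lemma series_apply_closed:
  assumes "\<And>i. F i \<in> carrier M \<rightarrow> carrier M" "\<And>i. w i \<in> carrier M"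
  shows "series_apply M F w n \<in> carrier M"
  using assms unfolding series_apply_def by (intro M.finsum_closed) (auto simp: Pi_iff)

lemma series_apply_cong:
  assumes "\<And>i. G i \<in> carrier M \<rightarrow> carrier M" "\<And>i. v i \<in> carrier M"
    "\<And>i m. m \<in> carrier M \<Longrightarrow> F i m = G i m" "\<And>i. w i = v i"
  shows "series_apply M F w n = series_apply M G v n"
  unfolding series_apply_def
  by (rule M.finsum_cong') (use assms in \<open>simp_all add: Pi_iff\<close>)

lemma series_apply_add:
  assumes F: "\<And>i. F i \<in> linear_operators R M" and w: "\<And>i. w i \<in> carrier M" "\<And>i. v i \<in> carrier M"
  shows "series_apply M F (\<lambda>i. w i \<oplus>\<^bsub>M\<^esub> v i) n = series_apply M F w n \<oplus>\<^bsub>M\<^esub> series_apply M F v n"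
proof -
  have "series_apply M F (\<lambda>i. w i \<oplus>\<^bsub>M\<^esub> v i) n
      = (\<Oplus>\<^bsub>M\<^esub>i\<in>{..n}. F i (w (n - i)) \<oplus>\<^bsub>M\<^esub> F i (v (n - i)))"
    unfolding series_apply_def
    by (rule M.finsum_cong') (auto simp: operator_add[OF F] operator_closed[OF F] w)
  also have "\<dots> = series_apply M F w n \<oplus>\<^bsub>M\<^esub> series_apply M F v n"
    unfolding series_apply_def
    by (rule M.finsum_addf) (auto simp: operator_closed[OF F] w)
  finally show ?thesis .
qed

lemma series_apply_minus:
  assumes F: "\<And>i. F i \<in> linear_operators R M" and w: "\<And>i. w i \<in> carrier M" "\<And>i. v i \<in> carrier M"
  shows "series_apply M F (\<lambda>i. w i \<ominus>\<^bsub>M\<^esub> v i) n = series_apply M F w n \<ominus>\<^bsub>M\<^esub> series_apply M F v n"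
proof -
  have "series_apply M F (\<lambda>i. w i \<ominus>\<^bsub>M\<^esub> v i) n
      = (\<Oplus>\<^bsub>M\<^esub>i\<in>{..n}. F i (w (n - i)) \<ominus>\<^bsub>M\<^esub> F i (v (n - i)))"
    unfolding series_apply_def
    by (rule M.finsum_cong') (auto simp: operator_minus[OF F] operator_closed[OF F] w)
  also have "\<dots> = series_apply M F w n \<ominus>\<^bsub>M\<^esub> series_apply M F v n"
    unfolding series_apply_def
    by (rule M.finsum_minus) (auto simp: operator_closed[OF F] w)
  finally show ?thesis .
qed

lemma series_apply_uminus:
  assumes F: "\<And>i. F i \<in> carrier M \<rightarrow> carrier M" and w: "\<And>i. w i \<in> carrier M"
    and G: "\<And>i m. m \<in> carrier M \<Longrightarrow> G i m = \<ominus>\<^bsub>M\<^esub> F i m"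
  shows "series_apply M G w n = \<ominus>\<^bsub>M\<^esub> series_apply M F w n"
proof -
  have "\<ominus>\<^bsub>M\<^esub> series_apply M F w n = (\<Oplus>\<^bsub>M\<^esub>i\<in>{..n}. \<ominus>\<^bsub>M\<^esub> (F i (w (n - i))))"
    unfolding series_apply_def
    by (rule additive_finsum[OF M.abelian_group_axioms M.abelian_group_axioms])
      (use F w in \<open>auto simp: M.minus_add Pi_iff\<close>)
  also have "\<dots> = series_apply M G w n"
    unfolding series_apply_def
    by (rule M.finsum_cong') (use F w G in \<open>auto simp: Pi_iff\<close>)
  finally show ?thesis ..
qed

lemma series_apply_apply:
  assumes F: "\<And>i. F i \<in> linear_operators R M" and G: "\<And>i. G i \<in> carrier M \<rightarrow> carrier M"
    and w: "\<And>i. w i \<in> carrier M"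
  shows "series_apply M F (series_apply M G w) n =
    series_apply M (\<lambda>k m. \<Oplus>\<^bsub>M\<^esub>i\<in>{..k}. F i (G (k - i) m)) w n"
proof -
  have G': "G i m \<in> carrier M" if "m \<in> carrier M" for i m using G that by auto
  have "series_apply M F (series_apply M G w) n
      = (\<Oplus>\<^bsub>M\<^esub>i\<in>{..n}. \<Oplus>\<^bsub>M\<^esub>j\<in>{..n - i}. F i (G j (w (n - (i + j)))))"
    unfolding series_apply_def
    by (rule M.finsum_cong') (auto simp: operator_finsum[OF F] operator_closed[OF F] G' w)
  also have "\<dots> = (\<Oplus>\<^bsub>M\<^esub>k\<in>{..n}. \<Oplus>\<^bsub>M\<^esub>i\<in>{..k}. F i (G (k - i) (w (n - (i + (k - i))))))"
    by (rule M.finsum_triangle) (auto simp: operator_closed[OF F] G' w)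
  also have "\<dots> = series_apply M (\<lambda>k m. \<Oplus>\<^bsub>M\<^esub>i\<in>{..k}. F i (G (k - i) m)) w n"
    unfolding series_apply_def
    by (intro M.finsum_cong') (auto intro!: M.finsum_cong' simp: operator_closed[OF F] G' w)
  finally show ?thesis .
qed

lemma series_apply_commute:
  assumes F: "\<And>i. F i \<in> linear_operators R M" and G: "\<And>i. G i \<in> linear_operators R M"
    and w: "\<And>i. w i \<in> carrier M"
    and FG: "\<And>i j m. m \<in> carrier M \<Longrightarrow> F i (G j m) = G j (F i m)"
  shows "series_apply M F (series_apply M G w) n = series_apply M G (series_apply M F w) n"
proof -
  note cl = operator_closed[OF F] operator_closed[OF G]
  have "(\<Oplus>\<^bsub>M\<^esub>i\<in>{..k}. F i (G (k - i) m)) = (\<Oplus>\<^bsub>M\<^esub>i\<in>{..k}. G i (F (k - i) m))"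
    if m: "m \<in> carrier M" for k m
  proof -
    have "(\<Oplus>\<^bsub>M\<^esub>i\<in>{..k}. G i (F (k - i) m)) = (\<Oplus>\<^bsub>M\<^esub>i\<in>{..k}. G (k - i) (F (k - (k - i)) m))"
      by (rule M.finsum_rev[symmetric]) (auto simp: cl m)
    also have "\<dots> = (\<Oplus>\<^bsub>M\<^esub>i\<in>{..k}. F i (G (k - i) m))"
      by (rule M.finsum_cong') (auto simp: cl m FG)
    finally show ?thesis ..
  qed
  then show ?thesis
    unfolding series_apply_apply[OF F operator_funcset[OF G] w]
      series_apply_apply[OF G operator_funcset[OF F] w]
    by (intro series_apply_cong) (auto intro!: M.finsum_closed simp: cl w)
qed

text \<open>
  A series \<open>\<theta>\<close> with constant term the identity can be cancelled on the right.  By induction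
  the coefficients below \<open>n\<close> agree, so the two sums differ only in the terms \<open>F n (\<theta> 0 m)\<close> and
  \<open>G n (\<theta> 0 m)\<close>.
\<close>

lemma series_apply_unique:
  fixes \<theta> :: "nat \<Rightarrow> 'c \<Rightarrow> 'c"
  assumes F: "\<And>i. F i \<in> carrier M \<rightarrow> carrier M" and G: "\<And>i. G i \<in> carrier M \<rightarrow> carrier M"
    and \<theta>: "\<And>i m. m \<in> carrier M \<Longrightarrow> \<theta> i m \<in> carrier M" and \<theta>0: "\<And>m. m \<in> carrier M \<Longrightarrow> \<theta> 0 m = m"
    and eq: "\<And>n m. m \<in> carrier M \<Longrightarrow>
       series_apply M F (\<lambda>i. \<theta> i m) n = series_apply M G (\<lambda>i. \<theta> i m) n"
    and m: "m \<in> carrier M"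
  shows "F n m = G n m"
  using m
proof (induction n arbitrary: m rule: less_induct)
  case (less n)
  have cl: "F i m \<in> carrier M" "G i m \<in> carrier M" if "m \<in> carrier M" for i m
    using F G that by auto
  have "F n m \<oplus>\<^bsub>M\<^esub> (\<Oplus>\<^bsub>M\<^esub>i\<in>{..<n}. F i (\<theta> (n - i) m)) = series_apply M F (\<lambda>i. \<theta> i m) n"
    unfolding series_apply_def by (subst M.finsum_atMost_last) (auto simp: cl \<theta> \<theta>0 less.prems)
  also have "\<dots> = series_apply M G (\<lambda>i. \<theta> i m) n"
    using less.prems by (rule eq)
  also have "\<dots> = G n m \<oplus>\<^bsub>M\<^esub> (\<Oplus>\<^bsub>M\<^esub>i\<in>{..<n}. G i (\<theta> (n - i) m))"
    unfolding series_apply_def by (subst M.finsum_atMost_last) (auto simp: cl \<theta> \<theta>0 less.prems)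
  also have "(\<Oplus>\<^bsub>M\<^esub>i\<in>{..<n}. G i (\<theta> (n - i) m)) = (\<Oplus>\<^bsub>M\<^esub>i\<in>{..<n}. F i (\<theta> (n - i) m))"
    by (rule M.finsum_cong') (auto simp: cl \<theta> less)
  finally show ?case
    by (simp add: cl \<theta> less.prems)
qed

lemma series_apply_zero:
  assumes "\<And>i m. m \<in> carrier M \<Longrightarrow> F i m = \<zero>\<^bsub>M\<^esub>" "\<And>i. w i \<in> carrier M"
  shows "series_apply M F w n = \<zero>\<^bsub>M\<^esub>"
  unfolding series_apply_def by (rule M.add.finprod_one_eqI) (simp add: assms)

lemma series_apply_one:
  assumes w: "\<And>i. w i \<in> carrier M"
  shows "series_apply M (\<lambda>i m. if i = 0 then m else \<zero>\<^bsub>M\<^esub>) w n = w n"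
proof -
  have "series_apply M (\<lambda>i m. if i = 0 then m else \<zero>\<^bsub>M\<^esub>) w n
      = (\<Oplus>\<^bsub>M\<^esub>i\<in>{..n}. if 0 = i then w (n - i) else \<zero>\<^bsub>M\<^esub>)"
    unfolding series_apply_def by (rule M.finsum_cong') (auto simp: w)
  also have "\<dots> = w (n - 0)"
    by (rule M.finsum_singleton) (auto simp: w)
  finally show ?thesis by simp
qed

end

section \<open>Central elements\<close>

lemma centerD: "z \<in> center T \<Longrightarrow> z \<in> carrier T"
  "\<lbrakk>z \<in> center T; x \<in> carrier T\<rbrakk> \<Longrightarrow> z \<otimes>\<^bsub>T\<^esub> x = x \<otimes>\<^bsub>T\<^esub> z"
  by (auto simp: center_def)

context ring
begin

lemma commutator_closed: "\<lbrakk>x \<in> carrier R; y \<in> carrier R\<rbrakk> \<Longrightarrow> commutator R x y \<in> carrier R"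
  by (simp add: commutator_def)

lemma commutator_center:
  assumes "x \<in> center R" "y \<in> carrier R"
  shows "commutator R x y = \<zero>"
  using centerD(1)[OF assms(1)] centerD(2)[OF assms] assms(2)
  by (simp add: commutator_def a_minus_def r_neg)

text \<open>
  If the series \<open>u\<close> commutes with a deformation \<open>v a\<close> of every ring element \<open>a\<close>, its coefficients
  are central: once those below \<open>n\<close> are known to be central, only the commutator of \<open>u n\<close> with
  \<open>v a 0 = a\<close> is left in the coefficient of \<open>t\<^sup>n\<close>.
\<close>

lemma center_if_series_commutes:
  fixes u :: "nat \<Rightarrow> 'a" and v :: "'a \<Rightarrow> nat \<Rightarrow> 'a"
  assumes u: "\<And>i. u i \<in> carrier R" and v: "\<And>a i. a \<in> carrier R \<Longrightarrow> v a i \<in> carrier R"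
    and v0: "\<And>a. a \<in> carrier R \<Longrightarrow> v a 0 = a"
    and comm: "\<And>a n. a \<in> carrier R \<Longrightarrow> (\<Oplus>i\<in>{..n}. commutator R (u i) (v a (n - i))) = \<zero>"
  shows "u n \<in> center R"
proof (induction n rule: less_induct)
  case (less n)
  have "u n \<otimes> a = a \<otimes> u n" if a: "a \<in> carrier R" for a
  proof -
    have "(\<Oplus>i\<in>{..<n}. commutator R (u i) (v a (n - i))) = \<zero>"
      by (rule add.finprod_one_eqI) (simp add: commutator_center less v a)
    then have "commutator R (u n) a = \<zero>"
      using comm[OF a, of n]
      by (subst (asm) finsum_atMost_last) (auto simp: commutator_closed u v v0 a)
    then show ?thesis
      using a u[of n] add.inv_solve_right'[of \<zero> "u n \<otimes> a" "a \<otimes> u n"]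
      by (simp add: commutator_def a_minus_def)
  qed
  with u show ?case by (auto simp: center_def)
qed

end

section \<open>Lie higher derivations of a triangular algebra\<close>

locale triangular_lie_higher_derivation = triangular +
  fixes L
  assumes L: "lie_higher_derivation R T L"
begin

definition "pA n x = fst (L n x)"
definition "pM n x = fst (snd (L n x))"
definition "pB n x = snd (snd (L n x))"

lemma L_eq: "L n x = (pA n x, pM n x, pB n x)"
  by (simp add: pA_def pM_def pB_def)

lemma L_linear: "L n \<in> linear_maps R T T"
  and L_0: "x \<in> carrier T \<Longrightarrow> L 0 x = x"
  and L_commutator: "\<lbrakk>x \<in> carrier T; y \<in> carrier T\<rbrakk> \<Longrightarrow> L n (commutator T x y) =
          (\<Oplus>\<^bsub>T\<^esub>i \<in> {..n}. commutator T (L i x) (L (n - i) y))"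
  using L unfolding lie_higher_derivation_def by blast+

lemma component_closed:
  assumes "x \<in> carrier T"
  shows "pA n x \<in> carrier A" "pM n x \<in> carrier M" "pB n x \<in> carrier B"
  using linear_maps_closed[OF L_linear assms, of n] by (auto simp: L_eq)

lemma component_0:
  assumes "(a, m, b) \<in> carrier T"
  shows "pA 0 (a, m, b) = a" "pM 0 (a, m, b) = m" "pB 0 (a, m, b) = b"
  using L_0[OF assms] by (auto simp: L_eq)

lemma component_add:
  assumes "x \<in> carrier T" "y \<in> carrier T"
  shows "pA n (x \<oplus>\<^bsub>T\<^esub> y) = pA n x \<oplus>\<^bsub>A\<^esub> pA n y"
    "pM n (x \<oplus>\<^bsub>T\<^esub> y) = pM n x \<oplus>\<^bsub>M\<^esub> pM n y"
    "pB n (x \<oplus>\<^bsub>T\<^esub> y) = pB n x \<oplus>\<^bsub>B\<^esub> pB n y"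
  using linear_maps_add[OF L_linear assms, of n] by (auto simp: L_eq)

lemma component_smult:
  assumes "c \<in> carrier R" "x \<in> carrier T"
  shows "pA n (c \<odot>\<^bsub>T\<^esub> x) = c \<odot>\<^bsub>A\<^esub> pA n x"
    "pM n (c \<odot>\<^bsub>T\<^esub> x) = c \<odot>\<^bsub>M\<^esub> pM n x"
    "pB n (c \<odot>\<^bsub>T\<^esub> x) = c \<odot>\<^bsub>B\<^esub> pB n x"
  using linear_maps_smult[OF L_linear assms, of n] by (auto simp: L_eq)

lemma component_zero:
  "pA n (\<zero>\<^bsub>A\<^esub>, \<zero>\<^bsub>M\<^esub>, \<zero>\<^bsub>B\<^esub>) = \<zero>\<^bsub>A\<^esub>"
  "pM n (\<zero>\<^bsub>A\<^esub>, \<zero>\<^bsub>M\<^esub>, \<zero>\<^bsub>B\<^esub>) = \<zero>\<^bsub>M\<^esub>"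
  "pB n (\<zero>\<^bsub>A\<^esub>, \<zero>\<^bsub>M\<^esub>, \<zero>\<^bsub>B\<^esub>) = \<zero>\<^bsub>B\<^esub>"
  using additive_zero[OF Tri_abelian_group Tri_abelian_group _ linear_maps_add[OF L_linear[of n]]]
    linear_maps_closed[OF L_linear[of n]]
  by (auto simp: L_eq Pi_iff)

text \<open>
  The adjoint action of the diagonal part of \<open>L n x\<close> on the corner \<open>M\<close>.
\<close>

definition "D n x = (\<lambda>m\<in>carrier M. lact (pA n x) m \<ominus>\<^bsub>M\<^esub> ract m (pB n x))"

lemma D_operator:
  assumes "x \<in> carrier T"
  shows "D n x \<in> linear_operators R M"
proof -
  have "D n x = (\<lambda>m\<in>carrier M. lmul (pA n x) m \<ominus>\<^bsub>M\<^esub> rmul (pB n x) m)"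
    by (auto simp: D_def lmul_def rmul_def)
  then show ?thesis
    using assms by (simp add: M.minus_operator lmul_operator rmul_operator component_closed)
qed

text \<open>
  The Lie identity entry by entry.  The middle entry expresses that \<open>pM\<close> is a cocycle for the
  action \<open>D\<close>.
\<close>

lemma component_commutator:
  assumes x: "x \<in> carrier T" and y: "y \<in> carrier T"
  shows "pA n (commutator T x y) = (\<Oplus>\<^bsub>A\<^esub>i\<in>{..n}. commutator A (pA i x) (pA (n - i) y))"
    and "pM n (commutator T x y) =
      series_apply M (\<lambda>i. D i x) (\<lambda>i. pM i y) n \<ominus>\<^bsub>M\<^esub> series_apply M (\<lambda>i. D i y) (\<lambda>i. pM i x) n"
    and "pB n (commutator T x y) = (\<Oplus>\<^bsub>B\<^esub>i\<in>{..n}. commutator B (pB i x) (pB (n - i) y))"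
proof -
  note cl = component_closed[OF x] component_closed[OF y]
  note Dcl = M.operator_closed[OF D_operator[OF x]] M.operator_closed[OF D_operator[OF y]]
  have "commutator T (L i x) (L j y) =
      (commutator A (pA i x) (pA j y), D i x (pM j y) \<ominus>\<^bsub>M\<^esub> D j y (pM i x),
       commutator B (pB i x) (pB j y))" for i j
    unfolding L_eq[of i x] L_eq[of j y]
    by (subst Tri_commutator) (simp_all add: cl D_def M.minus_regroup lact_closed ract_closed)
  then have "L n (commutator T x y) =
     (\<Oplus>\<^bsub>T\<^esub>i\<in>{..n}. (commutator A (pA i x) (pA (n - i) y),
        D i x (pM (n - i) y) \<ominus>\<^bsub>M\<^esub> D (n - i) y (pM i x),
        commutator B (pB i x) (pB (n - i) y)))"
    by (simp add: L_commutator[OF x y])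
  also have "\<dots> = ((\<Oplus>\<^bsub>A\<^esub>i\<in>{..n}. commutator A (pA i x) (pA (n - i) y)),
      (\<Oplus>\<^bsub>M\<^esub>i\<in>{..n}. D i x (pM (n - i) y) \<ominus>\<^bsub>M\<^esub> D (n - i) y (pM i x)),
      (\<Oplus>\<^bsub>B\<^esub>i\<in>{..n}. commutator B (pB i x) (pB (n - i) y)))"
    by (rule Tri_finsum)
      (auto simp: cl A.commutator_closed B.commutator_closed Dcl)
  finally have *: "L n (commutator T x y) = \<dots>" .
  show "pA n (commutator T x y) = (\<Oplus>\<^bsub>A\<^esub>i\<in>{..n}. commutator A (pA i x) (pA (n - i) y))"
    "pB n (commutator T x y) = (\<Oplus>\<^bsub>B\<^esub>i\<in>{..n}. commutator B (pB i x) (pB (n - i) y))"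
    using * by (simp_all add: L_eq)
  have "pM n (commutator T x y) =
      (\<Oplus>\<^bsub>M\<^esub>i\<in>{..n}. D i x (pM (n - i) y) \<ominus>\<^bsub>M\<^esub> D (n - i) y (pM i x))"
    using * by (simp add: L_eq)
  also have "\<dots> = series_apply M (\<lambda>i. D i x) (\<lambda>i. pM i y) n
      \<ominus>\<^bsub>M\<^esub> (\<Oplus>\<^bsub>M\<^esub>i\<in>{..n}. D (n - i) y (pM i x))"
    unfolding series_apply_def
    by (rule M.finsum_minus) (auto simp: cl Dcl)
  also have "(\<Oplus>\<^bsub>M\<^esub>i\<in>{..n}. D (n - i) y (pM i x)) = (\<Oplus>\<^bsub>M\<^esub>i\<in>{..n}. D (n - i) y (pM (n - (n - i)) x))"
    by (rule M.finsum_cong') (auto simp: cl Dcl)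
  also have "\<dots> = series_apply M (\<lambda>i. D i y) (\<lambda>i. pM i x) n"
    unfolding series_apply_def
    by (rule M.finsum_rev) (auto simp: cl Dcl)
  finally show "pM n (commutator T x y) =
      series_apply M (\<lambda>i. D i x) (\<lambda>i. pM i y) n \<ominus>\<^bsub>M\<^esub> series_apply M (\<lambda>i. D i y) (\<lambda>i. pM i x) n" .
qed

abbreviation "inA a \<equiv> (a, \<zero>\<^bsub>M\<^esub>, \<zero>\<^bsub>B\<^esub>)"
abbreviation "inM m \<equiv> (\<zero>\<^bsub>A\<^esub>, m, \<zero>\<^bsub>B\<^esub>)"
abbreviation "inB b \<equiv> (\<zero>\<^bsub>A\<^esub>, \<zero>\<^bsub>M\<^esub>, b)"
abbreviation "e \<equiv> inA \<one>\<^bsub>A\<^esub>"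

lemma commutator_corners:
  "\<lbrakk>a \<in> carrier A; a' \<in> carrier A\<rbrakk> \<Longrightarrow> commutator T (inA a) (inA a') = inA (commutator A a a')"
  "\<lbrakk>b \<in> carrier B; b' \<in> carrier B\<rbrakk> \<Longrightarrow> commutator T (inB b) (inB b') = inB (commutator B b b')"
  "\<lbrakk>a \<in> carrier A; b \<in> carrier B\<rbrakk> \<Longrightarrow> commutator T (inA a) (inB b) = inM \<zero>\<^bsub>M\<^esub>"
  "\<lbrakk>a \<in> carrier A; b \<in> carrier B\<rbrakk> \<Longrightarrow> commutator T (inB b) (inA a) = inM \<zero>\<^bsub>M\<^esub>"
  "\<lbrakk>a \<in> carrier A; m \<in> carrier M\<rbrakk> \<Longrightarrow> commutator T (inA a) (inM m) = inM (lact a m)"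
  "\<lbrakk>m \<in> carrier M; b \<in> carrier B\<rbrakk> \<Longrightarrow> commutator T (inM m) (inB b) = inM (ract m b)"
  by (simp_all add: commutator_def Tri_minus lact_closed ract_closed lact_zero_right
      lact_zero_left ract_zero_right ract_zero_left A.minus_self B.minus_self M.minus_self
      M.minus_zero_right)

lemma commutator_e:
  "a \<in> carrier A \<Longrightarrow> commutator T e (inA a) = inM \<zero>\<^bsub>M\<^esub>"
  "b \<in> carrier B \<Longrightarrow> commutator T e (inB b) = inM \<zero>\<^bsub>M\<^esub>"
  "m \<in> carrier M \<Longrightarrow> commutator T e (inM m) = inM m"
  by (simp_all add: commutator_corners lact_one) (simp add: commutator_def A.minus_self)

lemma in_closed [simp]:
  "a \<in> carrier A \<Longrightarrow> inA a \<in> carrier T" "b \<in> carrier B \<Longrightarrow> inB b \<in> carrier T"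
  "m \<in> carrier M \<Longrightarrow> inM m \<in> carrier T"
  by simp_all

text \<open>
  In this and the next three lemmas, a fixed diagonal element commutes with all elements of one
  diagonal corner, so the entry of its image in that corner commutes with the deformation of the
  corner by \<open>L\<close>.
\<close>

lemma center_pA_e: "pA n e \<in> center A"
proof (rule A.center_if_series_commutes[where v = "\<lambda>a i. pA i (inA a)"])
  fix a n assume "a \<in> carrier A"
  then show "(\<Oplus>\<^bsub>A\<^esub>i\<in>{..n}. commutator A (pA i e) (pA (n - i) (inA a))) = \<zero>\<^bsub>A\<^esub>"
    using component_commutator(1)[of e "inA a" n] commutator_e(1)[of a] component_zero by simp
qed (auto simp: component_closed component_0)

lemma center_pB_e: "pB n e \<in> center B"
proof (rule B.center_if_series_commutes[where v = "\<lambda>b i. pB i (inB b)"])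
  fix b n assume "b \<in> carrier B"
  then show "(\<Oplus>\<^bsub>B\<^esub>i\<in>{..n}. commutator B (pB i e) (pB (n - i) (inB b))) = \<zero>\<^bsub>B\<^esub>"
    using component_commutator(3)[of e "inB b" n] commutator_corners(3)[of "\<one>\<^bsub>A\<^esub>" b] component_zero by simp
qed (auto simp: component_closed component_0)

lemma center_pA_inB: "b \<in> carrier B \<Longrightarrow> pA n (inB b) \<in> center A"
proof (rule A.center_if_series_commutes[where v = "\<lambda>a i. pA i (inA a)"])
  fix a n assume "a \<in> carrier A" "b \<in> carrier B"
  then show "(\<Oplus>\<^bsub>A\<^esub>i\<in>{..n}. commutator A (pA i (inB b)) (pA (n - i) (inA a))) = \<zero>\<^bsub>A\<^esub>"
    using component_commutator(1)[of "inB b" "inA a" n] commutator_corners(4)[of a b] component_zero by simp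
qed (auto simp: component_closed component_0)

lemma center_pB_inA: "a \<in> carrier A \<Longrightarrow> pB n (inA a) \<in> center B"
proof (rule B.center_if_series_commutes[where v = "\<lambda>b i. pB i (inB b)"])
  fix b n assume "a \<in> carrier A" "b \<in> carrier B"
  then show "(\<Oplus>\<^bsub>B\<^esub>i\<in>{..n}. commutator B (pB i (inA a)) (pB (n - i) (inB b))) = \<zero>\<^bsub>B\<^esub>"
    using component_commutator(3)[of "inA a" "inB b" n] commutator_corners(3)[of a b] component_zero by simp
qed (auto simp: component_closed component_0)

text \<open>
  Since \<open>inM m\<close> is the commutator of \<open>e\<close> and itself, its diagonal entries under \<open>L\<close> are sums of
  commutators with the central entries of the \<open>L i e\<close>.
\<close>

lemma component_inM:
  assumes m: "m \<in> carrier M"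
  shows "pA n (inM m) = \<zero>\<^bsub>A\<^esub>" "pB n (inM m) = \<zero>\<^bsub>B\<^esub>"
proof -
  have "pA n (inM m) = (\<Oplus>\<^bsub>A\<^esub>i\<in>{..n}. commutator A (pA i e) (pA (n - i) (inM m)))"
    using component_commutator(1)[of e "inM m" n] commutator_e(3)[OF m] m by simp
  also have "\<dots> = \<zero>\<^bsub>A\<^esub>"
    by (rule A.add.finprod_one_eqI) (simp add: A.commutator_center center_pA_e component_closed m)
  finally show "pA n (inM m) = \<zero>\<^bsub>A\<^esub>" .
  have "pB n (inM m) = (\<Oplus>\<^bsub>B\<^esub>i\<in>{..n}. commutator B (pB i e) (pB (n - i) (inM m)))"
    using component_commutator(3)[of e "inM m" n] commutator_e(3)[OF m] m by simp
  also have "\<dots> = \<zero>\<^bsub>B\<^esub>"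
    by (rule B.add.finprod_one_eqI) (simp add: B.commutator_center center_pB_e component_closed m)
  finally show "pB n (inM m) = \<zero>\<^bsub>B\<^esub>" .
qed

section \<open>The twisted actions of the corners\<close>

text \<open>
  The series \<open>\<theta>\<close> is the restriction of \<open>L\<close> to the corner \<open>M\<close>; \<open>P\<close> and \<open>Q\<close> turn out to be the left
  and right actions on \<open>M\<close> conjugated by \<open>\<theta>\<close>.  The sign in \<open>Q\<close> is there because \<open>D\<close> subtracts the
  right action.
\<close>

definition "\<theta> n m = pM n (inM m)"
definition "\<mu> n = pM n e"
definition "P n a = D n (inA a)"
definition "Q n b = (\<lambda>m\<in>carrier M. \<ominus>\<^bsub>M\<^esub> D n (inB b) m)"

lemma \<theta>_closed: "m \<in> carrier M \<Longrightarrow> \<theta> n m \<in> carrier M"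
  by (simp add: \<theta>_def component_closed)

lemma \<theta>_0: "m \<in> carrier M \<Longrightarrow> \<theta> 0 m = m"
  by (simp add: \<theta>_def component_0)

lemma \<mu>_closed: "\<mu> n \<in> carrier M"
  by (simp add: \<mu>_def component_closed)

lemma P_operator: "a \<in> carrier A \<Longrightarrow> P n a \<in> linear_operators R M"
  unfolding P_def by (rule D_operator) simp

lemma Q_apply:
  assumes "b \<in> carrier B" "m \<in> carrier M"
  shows "Q n b m = ract m (pB n (inB b)) \<ominus>\<^bsub>M\<^esub> lact (pA n (inB b)) m"
proof -
  have "\<ominus>\<^bsub>M\<^esub> (u \<oplus>\<^bsub>M\<^esub> \<ominus>\<^bsub>M\<^esub> v) = v \<oplus>\<^bsub>M\<^esub> \<ominus>\<^bsub>M\<^esub> u"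
    if "u \<in> carrier M" "v \<in> carrier M" for u v
    using that by (simp add: M.minus_add M.a_comm)
  then show ?thesis
    using assms by (simp add: Q_def D_def a_minus_def lact_closed ract_closed component_closed)
qed

lemma Q_eq:
  assumes "b \<in> carrier B"
  shows "Q n b = (\<lambda>m\<in>carrier M. rmul (pB n (inB b)) m \<ominus>\<^bsub>M\<^esub> lmul (pA n (inB b)) m)"
  by (rule extensionalityI[where A = "carrier M"])
    (use Q_apply[OF assms] in \<open>auto simp: Q_def lmul_def rmul_def\<close>)

lemma Q_operator: "b \<in> carrier B \<Longrightarrow> Q n b \<in> linear_operators R M"
  unfolding Q_eq by (intro M.minus_operator rmul_operator lmul_operator component_closed) simp_all

lemma series_apply_D_inM:
  assumes "m \<in> carrier M" "\<And>i. w i \<in> carrier M"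
  shows "series_apply M (\<lambda>i. D i (inM m)) w n = \<zero>\<^bsub>M\<^esub>"
  using assms
  by (intro M.series_apply_zero)
    (simp_all add: D_def component_inM lact_zero_left ract_zero_right M.minus_self)

lemma series_apply_D_inB:
  assumes b: "b \<in> carrier B" and w: "\<And>i. w i \<in> carrier M"
  shows "series_apply M (\<lambda>i. D i (inB b)) w n = \<ominus>\<^bsub>M\<^esub> series_apply M (\<lambda>i. Q i b) w n"
  by (rule M.series_apply_uminus)
    (use assms M.operator_funcset[OF Q_operator] M.operator_closed[OF D_operator] in \<open>auto simp: Q_def\<close>)

lemma series_apply_closed_ops:
  assumes "\<And>i. F i \<in> linear_operators R M" "\<And>i. w i \<in> carrier M"
  shows "series_apply M F w n \<in> carrier M"
  using assms by (intro M.series_apply_closed M.operator_funcset)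

text \<open>
  This and its right-hand analogue are the cocycle identity with one argument in the corner \<open>M\<close>,
  where \<open>D\<close> vanishes.
\<close>

lemma \<theta>_lact:
  assumes "a \<in> carrier A" "m \<in> carrier M"
  shows "\<theta> n (lact a m) = series_apply M (\<lambda>i. P i a) (\<lambda>i. \<theta> i m) n"
proof -
  have "\<theta> n (lact a m) = series_apply M (\<lambda>i. P i a) (\<lambda>i. \<theta> i m) n
      \<ominus>\<^bsub>M\<^esub> series_apply M (\<lambda>i. D i (inM m)) (\<lambda>i. pM i (inA a)) n"
    using component_commutator(2)[of "inA a" "inM m" n] assms
    by (simp add: commutator_corners \<theta>_def P_def)
  then show ?thesis
    using assms
    by (simp add: series_apply_D_inM component_closed M.minus_zero_right series_apply_closed_ops
        P_operator \<theta>_closed)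
qed

lemma \<theta>_ract:
  assumes "m \<in> carrier M" "b \<in> carrier B"
  shows "\<theta> n (ract m b) = series_apply M (\<lambda>i. Q i b) (\<lambda>i. \<theta> i m) n"
proof -
  have "\<theta> n (ract m b) = series_apply M (\<lambda>i. D i (inM m)) (\<lambda>i. pM i (inB b)) n
      \<ominus>\<^bsub>M\<^esub> series_apply M (\<lambda>i. D i (inB b)) (\<lambda>i. \<theta> i m) n"
    using component_commutator(2)[of "inM m" "inB b" n] assms
    by (simp add: commutator_corners \<theta>_def)
  then show ?thesis
    using assms
    by (simp add: series_apply_D_inM series_apply_D_inB component_closed series_apply_closed_ops
        Q_operator \<theta>_closed a_minus_def)
qed

text \<open>
  Left multiplication by the unit of \<open>A\<close> is the identity of \<open>M\<close>, so \<open>D e\<close> and the constant series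
  \<open>1\<close> have the same product with \<open>\<theta>\<close>.
\<close>

lemma D_e:
  assumes m: "m \<in> carrier M"
  shows "D n e m = (if n = 0 then m else \<zero>\<^bsub>M\<^esub>)"
proof (rule M.series_apply_unique[where \<theta> = \<theta> and G = "\<lambda>i m. if i = 0 then m else \<zero>\<^bsub>M\<^esub>"])
  show "D i e \<in> carrier M \<rightarrow> carrier M" for i
    by (rule M.operator_funcset[OF D_operator]) simp
  fix n m assume m: "m \<in> carrier M"
  have "series_apply M (\<lambda>i. D i e) (\<lambda>i. \<theta> i m) n = \<theta> n (lact \<one>\<^bsub>A\<^esub> m)"
    using m by (simp add: \<theta>_lact P_def)
  then show "series_apply M (\<lambda>i. D i e) (\<lambda>i. \<theta> i m) n =
      series_apply M (\<lambda>i m. if i = 0 then m else \<zero>\<^bsub>M\<^esub>) (\<lambda>i. \<theta> i m) n"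
    using m by (simp add: M.series_apply_one \<theta>_closed lact_one)
qed (use m in \<open>auto simp: \<theta>_closed \<theta>_0\<close>)

lemma series_apply_D_e:
  assumes "\<And>i. w i \<in> carrier M"
  shows "series_apply M (\<lambda>i. D i e) w n = w n"
proof -
  have "series_apply M (\<lambda>i. D i e) w n = series_apply M (\<lambda>i m. if i = 0 then m else \<zero>\<^bsub>M\<^esub>) w n"
    by (rule M.series_apply_cong) (auto simp: D_e assms)
  then show ?thesis by (simp add: M.series_apply_one assms)
qed

text \<open>
  As \<open>e\<close> commutes with the diagonal and \<open>D e\<close> acts as the identity, the cocycle is a coboundary on
  the diagonal.
\<close>

lemma pM_inA:
  assumes a: "a \<in> carrier A"
  shows "pM n (inA a) = series_apply M (\<lambda>i. P i a) \<mu> n"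
proof (rule M.eq_if_minus_eq_zero)
  show "pM n (inA a) \<ominus>\<^bsub>M\<^esub> series_apply M (\<lambda>i. P i a) \<mu> n = \<zero>\<^bsub>M\<^esub>"
    using component_commutator(2)[of e "inA a" n] a
    by (simp add: commutator_e component_zero series_apply_D_e component_closed P_def \<mu>_def[abs_def])
qed (use a in \<open>auto simp: component_closed series_apply_closed_ops P_operator \<mu>_closed\<close>)

lemma pM_inB:
  assumes b: "b \<in> carrier B"
  shows "pM n (inB b) = \<ominus>\<^bsub>M\<^esub> series_apply M (\<lambda>i. Q i b) \<mu> n"
proof (rule M.eq_if_minus_eq_zero)
  have "pM n (inB b) \<ominus>\<^bsub>M\<^esub> series_apply M (\<lambda>i. D i (inB b)) \<mu> n = \<zero>\<^bsub>M\<^esub>"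
    using component_commutator(2)[of e "inB b" n] b
    by (simp add: commutator_e component_zero series_apply_D_e component_closed \<mu>_def[abs_def])
  then show "pM n (inB b) \<ominus>\<^bsub>M\<^esub> \<ominus>\<^bsub>M\<^esub> series_apply M (\<lambda>i. Q i b) \<mu> n = \<zero>\<^bsub>M\<^esub>"
    using b by (simp add: series_apply_D_inB \<mu>_closed)
qed (use b in \<open>auto simp: component_closed series_apply_closed_ops Q_operator \<mu>_closed\<close>)

lemma corner_decomposition:
  assumes "(a, m, b) \<in> carrier T"
  shows "(a, m, b) = inM m \<oplus>\<^bsub>T\<^esub> (inA a \<oplus>\<^bsub>T\<^esub> inB b)"
  using assms by simp

lemma component_decomposition:
  assumes x: "(a, m, b) \<in> carrier T"
  shows "pA n (a, m, b) = pA n (inA a) \<oplus>\<^bsub>A\<^esub> pA n (inB b)"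
    and "pB n (a, m, b) = pB n (inA a) \<oplus>\<^bsub>B\<^esub> pB n (inB b)"
    and "pM n (a, m, b) = \<theta> n m \<oplus>\<^bsub>M\<^esub>
      (series_apply M (\<lambda>i. P i a) \<mu> n \<ominus>\<^bsub>M\<^esub> series_apply M (\<lambda>i. Q i b) \<mu> n)"
proof -
  from x have cl: "a \<in> carrier A" "m \<in> carrier M" "b \<in> carrier B" by auto
  have S: "inA a \<oplus>\<^bsub>T\<^esub> inB b \<in> carrier T" using cl by simp
  note eqs = component_add[OF in_closed(3)[OF cl(2)] S, folded corner_decomposition[OF x]]
    component_add[OF in_closed(1)[OF cl(1)] in_closed(2)[OF cl(3)]]
  show "pA n (a, m, b) = pA n (inA a) \<oplus>\<^bsub>A\<^esub> pA n (inB b)"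
    unfolding eqs using cl by (simp add: component_inM component_closed)
  show "pB n (a, m, b) = pB n (inA a) \<oplus>\<^bsub>B\<^esub> pB n (inB b)"
    unfolding eqs using cl by (simp add: component_inM component_closed)
  show "pM n (a, m, b) = \<theta> n m \<oplus>\<^bsub>M\<^esub>
      (series_apply M (\<lambda>i. P i a) \<mu> n \<ominus>\<^bsub>M\<^esub> series_apply M (\<lambda>i. Q i b) \<mu> n)"
    unfolding eqs using cl by (simp add: pM_inA pM_inB \<theta>_def a_minus_def)
qed

text \<open>
  Applied to \<open>\<theta>(m)\<close>, both sides give \<open>\<theta>(a a' m)\<close>, and \<open>\<theta>\<close> can be cancelled.  For \<open>Q\<close> the same
  argument reverses the factors.
\<close>

lemma P_mult:
  assumes "a \<in> carrier A" "a' \<in> carrier A" and m: "m \<in> carrier M"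
  shows "P n (a \<otimes>\<^bsub>A\<^esub> a') m = (\<Oplus>\<^bsub>M\<^esub>i\<in>{..n}. P i a (P (n - i) a' m))"
proof (rule M.series_apply_unique[where \<theta> = \<theta> and
      G = "\<lambda>n m. \<Oplus>\<^bsub>M\<^esub>i\<in>{..n}. P i a (P (n - i) a' m)"])
  note cl = M.operator_closed[OF P_operator]
  show "P i (a \<otimes>\<^bsub>A\<^esub> a') \<in> carrier M \<rightarrow> carrier M" for i
    using assms by (intro M.operator_funcset P_operator) simp
  show "(\<lambda>m. \<Oplus>\<^bsub>M\<^esub>j\<in>{..i}. P j a (P (i - j) a' m)) \<in> carrier M \<rightarrow> carrier M" for i
    using assms by (auto intro!: M.finsum_closed simp: cl)
  fix n m assume m: "m \<in> carrier M"
  have "series_apply M (\<lambda>i. P i (a \<otimes>\<^bsub>A\<^esub> a')) (\<lambda>i. \<theta> i m) n = \<theta> n (lact a (lact a' m))"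
    using assms m by (simp add: \<theta>_lact[symmetric] lact_mult)
  also have "\<dots> = series_apply M (\<lambda>i. P i a) (series_apply M (\<lambda>i. P i a') (\<lambda>i. \<theta> i m)) n"
    using assms m by (simp add: \<theta>_lact lact_closed)
  also have "\<dots> = series_apply M (\<lambda>n m. \<Oplus>\<^bsub>M\<^esub>i\<in>{..n}. P i a (P (n - i) a' m)) (\<lambda>i. \<theta> i m) n"
    using assms m by (intro M.series_apply_apply P_operator M.operator_funcset \<theta>_closed)
  finally show "series_apply M (\<lambda>i. P i (a \<otimes>\<^bsub>A\<^esub> a')) (\<lambda>i. \<theta> i m) n = \<dots>" .
qed (use m in \<open>auto simp: \<theta>_closed \<theta>_0\<close>)

lemma Q_mult:
  assumes "b \<in> carrier B" "b' \<in> carrier B" and m: "m \<in> carrier M"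
  shows "Q n (b \<otimes>\<^bsub>B\<^esub> b') m = (\<Oplus>\<^bsub>M\<^esub>i\<in>{..n}. Q i b' (Q (n - i) b m))"
proof (rule M.series_apply_unique[where \<theta> = \<theta> and
      G = "\<lambda>n m. \<Oplus>\<^bsub>M\<^esub>i\<in>{..n}. Q i b' (Q (n - i) b m)"])
  note cl = M.operator_closed[OF Q_operator]
  show "Q i (b \<otimes>\<^bsub>B\<^esub> b') \<in> carrier M \<rightarrow> carrier M" for i
    using assms by (intro M.operator_funcset Q_operator) simp
  show "(\<lambda>m. \<Oplus>\<^bsub>M\<^esub>j\<in>{..i}. Q j b' (Q (i - j) b m)) \<in> carrier M \<rightarrow> carrier M" for i
    using assms by (auto intro!: M.finsum_closed simp: cl)
  fix n m assume m: "m \<in> carrier M"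
  have "series_apply M (\<lambda>i. Q i (b \<otimes>\<^bsub>B\<^esub> b')) (\<lambda>i. \<theta> i m) n = \<theta> n (ract (ract m b) b')"
    using assms m by (simp add: \<theta>_ract[symmetric] ract_mult)
  also have "\<dots> = series_apply M (\<lambda>i. Q i b') (series_apply M (\<lambda>i. Q i b) (\<lambda>i. \<theta> i m)) n"
    using assms m by (simp add: \<theta>_ract ract_closed)
  also have "\<dots> = series_apply M (\<lambda>n m. \<Oplus>\<^bsub>M\<^esub>i\<in>{..n}. Q i b' (Q (n - i) b m)) (\<lambda>i. \<theta> i m) n"
    using assms m by (intro M.series_apply_apply Q_operator M.operator_funcset \<theta>_closed)
  finally show "series_apply M (\<lambda>i. Q i (b \<otimes>\<^bsub>B\<^esub> b')) (\<lambda>i. \<theta> i m) n = \<dots>" .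
qed (use m in \<open>auto simp: \<theta>_closed \<theta>_0\<close>)

section \<open>The enlarged triangular algebra\<close>

text \<open>
  Besides the action of \<open>B\<close>, which \<open>A0\<close> must commute with, the commutant is taken of the centre of
  \<open>A\<close> as well: this is what puts the action of that centre into \<open>B0\<close>, while costing none of the
  operators coming from \<open>A\<close>.
\<close>

definition "A0 = commutant R M (rmul ` carrier B \<union> lmul ` center A)"
definition "B0 = commutant R M A0"

definition "T0 = Tri (operator_algebra M A0) (module_reduct M)
  (opposite_algebra (operator_algebra M B0)) (\<lambda>f m. f m) (\<lambda>m g. g m)"

lemma generators_operators: "rmul ` carrier B \<union> lmul ` center A \<subseteq> linear_operators R M"
  using lmul_operator rmul_operator centerD(1)[of _ A] by auto

lemma triangular_T0: "triangular R (operator_algebra M A0) (module_reduct M)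
  (opposite_algebra (operator_algebra M B0)) (\<lambda>f m. f m) (\<lambda>m g. g m)"
  unfolding A0_def B0_def by (rule M.triangular_operator_algebras[OF generators_operators])

lemma A0_operator: "f \<in> A0 \<Longrightarrow> f \<in> linear_operators R M"
  and B0_operator: "f \<in> B0 \<Longrightarrow> f \<in> linear_operators R M"
  using M.commutant_operators by (auto simp: A0_def B0_def)

lemma A0_add: "\<lbrakk>f \<in> A0; g \<in> A0\<rbrakk> \<Longrightarrow> (\<lambda>m\<in>carrier M. f m \<oplus>\<^bsub>M\<^esub> g m) \<in> A0"
  and A0_minus: "\<lbrakk>f \<in> A0; g \<in> A0\<rbrakk> \<Longrightarrow> (\<lambda>m\<in>carrier M. f m \<ominus>\<^bsub>M\<^esub> g m) \<in> A0"
  unfolding A0_def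
  by (rule M.commutant_add[OF generators_operators] M.commutant_minus[OF generators_operators], assumption+)+

lemma B0_add: "\<lbrakk>f \<in> B0; g \<in> B0\<rbrakk> \<Longrightarrow> (\<lambda>m\<in>carrier M. f m \<oplus>\<^bsub>M\<^esub> g m) \<in> B0"
  and B0_minus: "\<lbrakk>f \<in> B0; g \<in> B0\<rbrakk> \<Longrightarrow> (\<lambda>m\<in>carrier M. f m \<ominus>\<^bsub>M\<^esub> g m) \<in> B0"
  unfolding B0_def A0_def
  by (rule M.commutant_add[OF M.commutant_operators] M.commutant_minus[OF M.commutant_operators], assumption+)+

lemma A0_B0_commute: "\<lbrakk>f \<in> A0; g \<in> B0; m \<in> carrier M\<rbrakk> \<Longrightarrow> f (g m) = g (f m)"
  unfolding B0_def by (rule M.commutantD[symmetric])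

lemma lmul_A0: "a \<in> carrier A \<Longrightarrow> lmul a \<in> A0"
  unfolding A0_def
proof (rule M.commutantI)
  fix s m assume a: "a \<in> carrier A" and s: "s \<in> rmul ` carrier B \<union> lmul ` center A"
    and m: "m \<in> carrier M"
  from s show "lmul a (s m) = s (lmul a m)"
  proof
    assume "s \<in> rmul ` carrier B"
    then show ?thesis
      using a m by (auto simp: lmul_def rmul_def lact_closed ract_closed lact_ract)
  next
    assume "s \<in> lmul ` center A"
    then obtain z where z: "s = lmul z" "z \<in> center A" by auto
    then show ?thesis
      using a m centerD[OF z(2)] by (simp add: lmul_def lact_closed lact_mult[symmetric])
  qed
qed (rule lmul_operator)

lemma rmul_A0:
  assumes z: "z \<in> center B"
  shows "rmul z \<in> A0"
  unfolding A0_def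
proof (rule M.commutantI)
  note z' = centerD[OF z]
  show "rmul z \<in> linear_operators R M"
    by (rule rmul_operator) (rule z')
  fix s m assume s: "s \<in> rmul ` carrier B \<union> lmul ` center A" and m: "m \<in> carrier M"
  from s show "rmul z (s m) = s (rmul z m)"
  proof
    assume "s \<in> rmul ` carrier B"
    then show ?thesis
      using z' m by (auto simp: rmul_def ract_closed ract_mult[symmetric])
  next
    assume "s \<in> lmul ` center A"
    then show ?thesis
      using z' m centerD(1)[of _ A] by (auto simp: lmul_def rmul_def lact_closed ract_closed lact_ract)
  qed
qed

lemma rmul_B0: "b \<in> carrier B \<Longrightarrow> rmul b \<in> B0"
  and lmul_B0: "z \<in> center A \<Longrightarrow> lmul z \<in> B0"
  using M.subset_bicommutant[OF generators_operators] by (auto simp: B0_def A0_def)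

lemma P_A0:
  assumes a: "a \<in> carrier A"
  shows "P n a \<in> A0"
proof -
  have "P n a = (\<lambda>m\<in>carrier M. lmul (pA n (inA a)) m \<ominus>\<^bsub>M\<^esub> rmul (pB n (inA a)) m)"
    by (auto simp: P_def D_def lmul_def rmul_def)
  then show ?thesis
    using a by (simp add: A0_minus lmul_A0 rmul_A0 center_pB_inA component_closed)
qed

lemma Q_B0:
  assumes b: "b \<in> carrier B"
  shows "Q n b \<in> B0"
  using Q_eq[OF b, of n] b
    B0_minus[OF rmul_B0[of "pB n (inB b)"] lmul_B0[OF center_pA_inB[OF b, of n]]]
  by (simp add: component_closed)

text \<open>
  The discrepancy between \<open>L n x\<close> and the multiplicative maps \<open>P\<close>, \<open>Q\<close>; it is the same operator in
  both diagonal entries.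
\<close>

definition "Z n = (\<lambda>(a, m, b). \<lambda>m'\<in>carrier M.
  rmul (pB n (inA a)) m' \<oplus>\<^bsub>M\<^esub> lmul (pA n (inB b)) m')"

lemma Z_A0: "x \<in> carrier T \<Longrightarrow> Z n x \<in> A0"
  by (auto simp: Z_def intro!: A0_add rmul_A0 lmul_A0 center_pB_inA component_closed)

lemma Z_B0: "x \<in> carrier T \<Longrightarrow> Z n x \<in> B0"
  by (auto simp: Z_def intro!: B0_add rmul_B0 lmul_B0 center_pA_inB component_closed)

section \<open>Splitting off the central part\<close>

definition "\<iota> = (\<lambda>(a, m, b). (lmul a, m, rmul b))"
definition "\<Delta> n = (\<lambda>(a, m, b). (P n a, pM n (a, m, b), Q n b))"
definition "\<chi> n x = (Z n x, \<zero>\<^bsub>M\<^esub>, Z n x)"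

lemma ext_operatorI:
  assumes "f \<in> extensional (carrier M)" "\<And>m. m \<in> carrier M \<Longrightarrow> f m = g m"
  shows "f = (\<lambda>m\<in>carrier M. g m)"
  by (rule extensionalityI[where A = "carrier M"]) (use assms in auto)

lemma \<iota>_linear: "\<iota> \<in> linear_maps R T T0"
proof (rule linear_mapsI)
  show "\<iota> x \<in> carrier T0" if "x \<in> carrier T" for x
    using that by (auto simp: T0_def \<iota>_def lmul_A0 rmul_B0)
  show "\<iota> (x \<oplus>\<^bsub>T\<^esub> y) = \<iota> x \<oplus>\<^bsub>T0\<^esub> \<iota> y" if "x \<in> carrier T" "y \<in> carrier T" for x y
    using that
    by (auto simp: T0_def \<iota>_def lmul_def rmul_def lact_add_left ract_add_right intro!: ext_operatorI)
  show "\<iota> (c \<odot>\<^bsub>T\<^esub> x) = c \<odot>\<^bsub>T0\<^esub> \<iota> x" if "c \<in> carrier R" "x \<in> carrier T" for c x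
    using that
    by (auto simp: T0_def \<iota>_def lmul_def rmul_def smult_lact_left smult_ract_right intro!: ext_operatorI)
qed

text \<open>Injectivity on the two corners is the faithfulness of the actions on \<open>M\<close>.\<close>

lemma \<iota>_embedding: "algebra_embedding R T T0 \<iota>"
  unfolding algebra_embedding_def
proof (intro conjI \<iota>_linear)
  show "\<iota> \<in> ring_hom T T0"
  proof (rule ring_hom_memI)
    fix x y assume xy: "x \<in> carrier T" "y \<in> carrier T"
    show "\<iota> x \<in> carrier T0" "\<iota> (x \<oplus>\<^bsub>T\<^esub> y) = \<iota> x \<oplus>\<^bsub>T0\<^esub> \<iota> y"
      using linear_maps_closed[OF \<iota>_linear] linear_maps_add[OF \<iota>_linear] xy by blast+
    from xy show "\<iota> (x \<otimes>\<^bsub>T\<^esub> y) = \<iota> x \<otimes>\<^bsub>T0\<^esub> \<iota> y"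
      by (auto simp: T0_def \<iota>_def lmul_def rmul_def lact_mult ract_mult lact_closed ract_closed
          intro!: ext_operatorI)
  next
    show "\<iota> \<one>\<^bsub>T\<^esub> = \<one>\<^bsub>T0\<^esub>"
      by (auto simp: T0_def \<iota>_def lmul_def rmul_def lact_one ract_one intro!: ext_operatorI)
  qed
  have A: "a = a'" if "a \<in> carrier A" "a' \<in> carrier A" "lmul a = lmul a'" for a a'
  proof -
    have "lact (a \<ominus>\<^bsub>A\<^esub> a') m = lmul a m \<ominus>\<^bsub>M\<^esub> lmul a' m" if m: "m \<in> carrier M" for m
      using additive_minus[OF A.is_abelian_group M.abelian_group_axioms,
          of "\<lambda>a. lact a m" a a'] m \<open>a \<in> carrier A\<close> \<open>a' \<in> carrier A\<close>
      by (auto simp: lmul_def lact_closed lact_add_left)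
    then have "a \<ominus>\<^bsub>A\<^esub> a' = \<zero>\<^bsub>A\<^esub>"
      using that M.operator_closed[OF A0_operator[OF lmul_A0]]
      by (intro faithful_left) (auto simp: M.minus_self)
    then show ?thesis by (rule A.eq_if_minus_eq_zero[OF that(1,2)])
  qed
  have B: "b = b'" if "b \<in> carrier B" "b' \<in> carrier B" "rmul b = rmul b'" for b b'
  proof -
    have "ract m (b \<ominus>\<^bsub>B\<^esub> b') = rmul b m \<ominus>\<^bsub>M\<^esub> rmul b' m" if m: "m \<in> carrier M" for m
      using additive_minus[OF B.is_abelian_group M.abelian_group_axioms,
          of "\<lambda>b. ract m b" b b'] m \<open>b \<in> carrier B\<close> \<open>b' \<in> carrier B\<close>
      by (auto simp: rmul_def ract_closed ract_add_right)
    then have "b \<ominus>\<^bsub>B\<^esub> b' = \<zero>\<^bsub>B\<^esub>"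
      using that M.operator_closed[OF B0_operator[OF rmul_B0]]
      by (intro faithful_right) (auto simp: M.minus_self)
    then show ?thesis by (rule B.eq_if_minus_eq_zero[OF that(1,2)])
  qed
  show "inj_on \<iota> (carrier T)"
    by (rule inj_onI) (auto simp: \<iota>_def intro: A B)
qed

lemma D_add:
  assumes "x \<in> carrier T" "y \<in> carrier T" "m \<in> carrier M"
  shows "D n (x \<oplus>\<^bsub>T\<^esub> y) m = D n x m \<oplus>\<^bsub>M\<^esub> D n y m"
  using assms
  by (simp add: D_def component_add component_closed lact_add_left ract_add_right lact_closed ract_closed
      a_minus_def M.minus_add M.a_ac del: Tri_simps)

lemma D_smult:
  assumes "c \<in> carrier R" "x \<in> carrier T" "m \<in> carrier M"
  shows "D n (c \<odot>\<^bsub>T\<^esub> x) m = c \<odot>\<^bsub>M\<^esub> D n x m"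
  using assms
  by (simp add: D_def component_smult component_closed smult_lact_left[symmetric] smult_ract_right[symmetric]
      lact_closed ract_closed a_minus_def M.smult_r_distr M.smult_uminus_right del: Tri_simps)

lemma corners_linear:
  "\<lbrakk>a \<in> carrier A; a' \<in> carrier A\<rbrakk> \<Longrightarrow> inA (a \<oplus>\<^bsub>A\<^esub> a') = inA a \<oplus>\<^bsub>T\<^esub> inA a'"
  "\<lbrakk>b \<in> carrier B; b' \<in> carrier B\<rbrakk> \<Longrightarrow> inB (b \<oplus>\<^bsub>B\<^esub> b') = inB b \<oplus>\<^bsub>T\<^esub> inB b'"
  "\<lbrakk>c \<in> carrier R; a \<in> carrier A\<rbrakk> \<Longrightarrow> inA (c \<odot>\<^bsub>A\<^esub> a) = c \<odot>\<^bsub>T\<^esub> inA a"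
  "\<lbrakk>c \<in> carrier R; b \<in> carrier B\<rbrakk> \<Longrightarrow> inB (c \<odot>\<^bsub>B\<^esub> b) = c \<odot>\<^bsub>T\<^esub> inB b"
  by simp_all

lemma P_add:
  assumes "a \<in> carrier A" "a' \<in> carrier A"
  shows "P n (a \<oplus>\<^bsub>A\<^esub> a') = (\<lambda>m\<in>carrier M. P n a m \<oplus>\<^bsub>M\<^esub> P n a' m)"
  using assms
  by (auto simp: P_def corners_linear D_add simp del: Tri_simps intro!: ext_operatorI)
    (simp add: D_def)

lemma P_smult:
  assumes "c \<in> carrier R" "a \<in> carrier A"
  shows "P n (c \<odot>\<^bsub>A\<^esub> a) = (\<lambda>m\<in>carrier M. c \<odot>\<^bsub>M\<^esub> P n a m)"
  using assms
  by (auto simp: P_def corners_linear D_smult simp del: Tri_simps intro!: ext_operatorI)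
    (simp add: D_def)

lemma Q_add:
  assumes "b \<in> carrier B" "b' \<in> carrier B"
  shows "Q n (b \<oplus>\<^bsub>B\<^esub> b') = (\<lambda>m\<in>carrier M. Q n b m \<oplus>\<^bsub>M\<^esub> Q n b' m)"
  using assms M.operator_closed[OF D_operator]
  by (auto simp: Q_def corners_linear D_add M.minus_add simp del: Tri_simps intro!: ext_operatorI)

lemma Q_smult:
  assumes "c \<in> carrier R" "b \<in> carrier B"
  shows "Q n (c \<odot>\<^bsub>B\<^esub> b) = (\<lambda>m\<in>carrier M. c \<odot>\<^bsub>M\<^esub> Q n b m)"
  using assms M.operator_closed[OF D_operator]
  by (auto simp: Q_def corners_linear D_smult M.smult_uminus_right simp del: Tri_simps intro!: ext_operatorI)

lemma \<Delta>_linear: "\<Delta> n \<in> linear_maps R T T0"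
proof (rule linear_mapsI)
  show "\<Delta> n x \<in> carrier T0" if "x \<in> carrier T" for x
    using that by (auto simp: T0_def \<Delta>_def P_A0 Q_B0 component_closed)
  show "\<Delta> n (x \<oplus>\<^bsub>T\<^esub> y) = \<Delta> n x \<oplus>\<^bsub>T0\<^esub> \<Delta> n y" if "x \<in> carrier T" "y \<in> carrier T" for x y
    using that component_add(2)[OF that, of n]
    by (auto simp: T0_def \<Delta>_def P_add Q_add)
  show "\<Delta> n (c \<odot>\<^bsub>T\<^esub> x) = c \<odot>\<^bsub>T0\<^esub> \<Delta> n x" if "c \<in> carrier R" "x \<in> carrier T" for c x
    using that component_smult(2)[OF that, of n]
    by (auto simp: T0_def \<Delta>_def P_smult Q_smult)
qed

text \<open>
  Substituting \<open>pM = \<theta> + P \<mu> - Q \<mu>\<close> on both sides, the multiplicativity of \<open>P\<close> and \<open>Q\<close> leaves the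
  two mixed terms \<open>P(a) Q(b') \<mu>\<close> and \<open>Q(b') P(a) \<mu>\<close> of opposite sign, which cancel because \<open>A0\<close>
  and \<open>B0\<close> commute.
\<close>

lemma pM_mult:
  assumes cl: "a \<in> carrier A" "m \<in> carrier M" "b \<in> carrier B"
    "a' \<in> carrier A" "m' \<in> carrier M" "b' \<in> carrier B"
  shows "pM n ((a, m, b) \<otimes>\<^bsub>T\<^esub> (a', m', b')) =
    series_apply M (\<lambda>i. P i a) (\<lambda>i. pM i (a', m', b')) n \<oplus>\<^bsub>M\<^esub>
    series_apply M (\<lambda>i. Q i b') (\<lambda>i. pM i (a, m, b)) n"
proof -
  note ops = P_operator[OF cl(1)] P_operator[OF cl(4)] Q_operator[OF cl(3)] Q_operator[OF cl(6)]
  let ?P = "\<lambda>a. series_apply M (\<lambda>i. P i a)" and ?Q = "\<lambda>b. series_apply M (\<lambda>i. Q i b)"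
  note closed = ops \<mu>_closed \<theta>_closed[OF cl(2)] \<theta>_closed[OF cl(5)] series_apply_closed_ops cl
  have PP: "?P (a \<otimes>\<^bsub>A\<^esub> a') \<mu> n = ?P a (?P a' \<mu>) n"
    unfolding M.series_apply_apply[OF ops(1) M.operator_funcset[OF ops(2)] \<mu>_closed]
    by (rule M.series_apply_cong)
      (auto simp: P_mult cl \<mu>_closed intro!: M.finsum_closed M.operator_closed[OF ops(1)]
        M.operator_closed[OF ops(2)])
  have QQ: "?Q (b \<otimes>\<^bsub>B\<^esub> b') \<mu> n = ?Q b' (?Q b \<mu>) n"
    unfolding M.series_apply_apply[OF ops(4) M.operator_funcset[OF ops(3)] \<mu>_closed]
    by (rule M.series_apply_cong)
      (auto simp: Q_mult cl \<mu>_closed intro!: M.finsum_closed M.operator_closed[OF ops(3)]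
        M.operator_closed[OF ops(4)])
  have PQ: "?Q b' (?P a \<mu>) n = ?P a (?Q b' \<mu>) n"
    by (rule M.series_apply_commute)
      (auto simp: closed A0_B0_commute[symmetric] P_A0 Q_B0)
  have \<theta>_add: "\<theta> n (lact a m' \<oplus>\<^bsub>M\<^esub> ract m b') = \<theta> n (lact a m') \<oplus>\<^bsub>M\<^esub> \<theta> n (ract m b')"
    using component_add(2)[of "inM (lact a m')" "inM (ract m b')" n] cl
    by (simp add: \<theta>_def lact_closed ract_closed)
  have "pM n ((a, m, b) \<otimes>\<^bsub>T\<^esub> (a', m', b')) =
      (?P a (\<lambda>i. \<theta> i m') n \<oplus>\<^bsub>M\<^esub> ?Q b' (\<lambda>i. \<theta> i m) n) \<oplus>\<^bsub>M\<^esub>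
      (?P a (?P a' \<mu>) n \<ominus>\<^bsub>M\<^esub> ?Q b' (?Q b \<mu>) n)"
    using cl
    by (simp add: component_decomposition(3) \<theta>_add PP QQ lact_closed ract_closed)
      (simp add: \<theta>_lact \<theta>_ract)
  \<comment> \<open>Inserting the mixed term twice with opposite signs lets the sum be regrouped by operator.\<close>
  also have "\<dots> = (?P a (\<lambda>i. \<theta> i m') n \<oplus>\<^bsub>M\<^esub> (?P a (?P a' \<mu>) n \<ominus>\<^bsub>M\<^esub> ?P a (?Q b' \<mu>) n)) \<oplus>\<^bsub>M\<^esub>
      (?Q b' (\<lambda>i. \<theta> i m) n \<oplus>\<^bsub>M\<^esub> (?P a (?Q b' \<mu>) n \<ominus>\<^bsub>M\<^esub> ?Q b' (?Q b \<mu>) n))"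
    by (rule M.add_diff_telescope[symmetric]) (intro closed)+
  also have "\<dots> = ?P a (\<lambda>i. \<theta> i m' \<oplus>\<^bsub>M\<^esub> (?P a' \<mu> i \<ominus>\<^bsub>M\<^esub> ?Q b' \<mu> i)) n \<oplus>\<^bsub>M\<^esub>
      ?Q b' (\<lambda>i. \<theta> i m \<oplus>\<^bsub>M\<^esub> (?P a \<mu> i \<ominus>\<^bsub>M\<^esub> ?Q b \<mu> i)) n"
    by (simp add: M.series_apply_add M.series_apply_minus closed PQ)
  finally show ?thesis
    using cl by (simp add: component_decomposition(3))
qed

lemma \<Delta>_mult:
  assumes x: "x \<in> carrier T" and y: "y \<in> carrier T"
  shows "\<Delta> n (x \<otimes>\<^bsub>T\<^esub> y) = (\<Oplus>\<^bsub>T0\<^esub>i\<in>{..n}. \<Delta> i x \<otimes>\<^bsub>T0\<^esub> \<Delta> (n - i) y)"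
proof -
  interpret T0: triangular R "operator_algebra M A0" "module_reduct M"
    "opposite_algebra (operator_algebra M B0)" "\<lambda>f m. f m" "\<lambda>m g. g m"
    by (rule triangular_T0)
  obtain a m b a' m' b' where xy: "x = (a, m, b)" "y = (a', m', b')"
    and cl: "a \<in> carrier A" "m \<in> carrier M" "b \<in> carrier B"
      "a' \<in> carrier A" "m' \<in> carrier M" "b' \<in> carrier B"
    using x y by auto
  let ?A = "operator_algebra M A0" and ?B = "operator_algebra M B0"
  let ?f = "\<lambda>i. P i a \<otimes>\<^bsub>?A\<^esub> P (n - i) a'"
  let ?g = "\<lambda>i. P i a (pM (n - i) y) \<oplus>\<^bsub>M\<^esub> Q (n - i) b' (pM i x)"
  let ?h = "\<lambda>i. Q (n - i) b' \<otimes>\<^bsub>?B\<^esub> Q i b"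
  note Pcl = M.operator_closed[OF P_operator] and Qcl = M.operator_closed[OF Q_operator]
  have B: "assoc_algebra R ?B"
    unfolding B0_def A0_def
    by (rule M.commutant_assoc_algebra[OF M.commutant_operators])
  interpret B: assoc_algebra R ?B by (rule B)
  have f: "?f i \<in> A0" for i
    using T0.A.m_closed[of "P i a" "P (n - i) a'"] cl by (simp add: P_A0)
  have h: "?h i \<in> B0" for i
    using B.m_closed[of "Q (n - i) b'" "Q i b"] cl by (simp add: Q_B0)
  have g: "?g i \<in> carrier M" for i
    using cl x y by (simp add: Pcl Qcl component_closed)
  have fsum: "P n (a \<otimes>\<^bsub>A\<^esub> a') = (\<Oplus>\<^bsub>?A\<^esub>i\<in>{..n}. ?f i)"
  proof (rule extensionalityI[where A = "carrier M"])
    have "(\<Oplus>\<^bsub>?A\<^esub>i\<in>{..n}. ?f i) \<in> A0"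
      using T0.A.finsum_closed[of ?f "{..n}"] f by simp
    then show "(\<Oplus>\<^bsub>?A\<^esub>i\<in>{..n}. ?f i) \<in> extensional (carrier M)"
      by (intro M.operator_ext A0_operator)
    show "P n (a \<otimes>\<^bsub>A\<^esub> a') \<in> extensional (carrier M)"
      using cl by (intro M.operator_ext P_operator) simp
    fix m assume m: "m \<in> carrier M"
    have "(\<Oplus>\<^bsub>?A\<^esub>i\<in>{..n}. ?f i) m = (\<Oplus>\<^bsub>M\<^esub>i\<in>{..n}. ?f i m)"
      by (rule M.operator_algebra_finsum[OF T0.A.is_abelian_group])
        (use f m A0_operator in auto)
    then show "P n (a \<otimes>\<^bsub>A\<^esub> a') m = (\<Oplus>\<^bsub>?A\<^esub>i\<in>{..n}. ?f i) m"
      using m cl by (simp add: P_mult)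
  qed
  have hsum: "Q n (b \<otimes>\<^bsub>B\<^esub> b') = (\<Oplus>\<^bsub>?B\<^esub>i\<in>{..n}. ?h i)"
  proof (rule extensionalityI[where A = "carrier M"])
    have "(\<Oplus>\<^bsub>?B\<^esub>i\<in>{..n}. ?h i) \<in> B0"
      using B.finsum_closed[of ?h "{..n}"] h by simp
    then show "(\<Oplus>\<^bsub>?B\<^esub>i\<in>{..n}. ?h i) \<in> extensional (carrier M)"
      by (intro M.operator_ext B0_operator)
    show "Q n (b \<otimes>\<^bsub>B\<^esub> b') \<in> extensional (carrier M)"
      using cl by (intro M.operator_ext Q_operator) simp
    fix m assume m: "m \<in> carrier M"
    have "(\<Oplus>\<^bsub>?B\<^esub>i\<in>{..n}. ?h i) m = (\<Oplus>\<^bsub>M\<^esub>i\<in>{..n}. ?h i m)"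
      by (rule M.operator_algebra_finsum[OF B.is_abelian_group])
        (use h m B0_operator in auto)
    \<comment> \<open>In the opposite product the index \<open>i\<close> belongs to \<open>b\<close>, in \<open>Q_mult\<close> to \<open>b'\<close>.\<close>
    also have "\<dots> = (\<Oplus>\<^bsub>M\<^esub>i\<in>{..n}. Q (n - i) b' (Q (n - (n - i)) b m))"
      by (rule M.finsum_cong') (use m cl Qcl in auto)
    also have "\<dots> = (\<Oplus>\<^bsub>M\<^esub>i\<in>{..n}. Q i b' (Q (n - i) b m))"
      by (rule M.finsum_rev) (use m cl Qcl in auto)
    also have "\<dots> = Q n (b \<otimes>\<^bsub>B\<^esub> b') m"
      using m cl by (simp add: Q_mult)
    finally show "Q n (b \<otimes>\<^bsub>B\<^esub> b') m = (\<Oplus>\<^bsub>?B\<^esub>i\<in>{..n}. ?h i) m" ..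
  qed
  have gsum: "pM n (x \<otimes>\<^bsub>T\<^esub> y) = (\<Oplus>\<^bsub>M\<^esub>i\<in>{..n}. ?g i)"
  proof -
    have "(\<Oplus>\<^bsub>M\<^esub>i\<in>{..n}. ?g i) = (\<Oplus>\<^bsub>M\<^esub>i\<in>{..n}. P i a (pM (n - i) y)) \<oplus>\<^bsub>M\<^esub>
        (\<Oplus>\<^bsub>M\<^esub>i\<in>{..n}. Q (n - i) b' (pM i x))"
      by (rule M.finsum_addf) (use cl x y in \<open>auto simp: Pcl Qcl component_closed\<close>)
    also have "(\<Oplus>\<^bsub>M\<^esub>i\<in>{..n}. Q (n - i) b' (pM i x)) =
        (\<Oplus>\<^bsub>M\<^esub>i\<in>{..n}. Q (n - i) b' (pM (n - (n - i)) x))"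
      by (rule M.finsum_cong') (use cl x in \<open>auto simp: Qcl component_closed\<close>)
    also have "\<dots> = (\<Oplus>\<^bsub>M\<^esub>i\<in>{..n}. Q i b' (pM (n - i) x))"
      by (rule M.finsum_rev) (use cl x in \<open>auto simp: Qcl component_closed\<close>)
    finally show ?thesis
      unfolding xy pM_mult[OF cl] series_apply_def ..
  qed
  have "(\<Oplus>\<^bsub>T0\<^esub>i\<in>{..n}. \<Delta> i x \<otimes>\<^bsub>T0\<^esub> \<Delta> (n - i) y) = (\<Oplus>\<^bsub>T0\<^esub>i\<in>{..n}. (?f i, ?g i, ?h i))"
    by (simp add: T0_def \<Delta>_def xy)
  also have "\<dots> = ((\<Oplus>\<^bsub>?A\<^esub>i\<in>{..n}. ?f i), (\<Oplus>\<^bsub>M\<^esub>i\<in>{..n}. ?g i), (\<Oplus>\<^bsub>?B\<^esub>i\<in>{..n}. ?h i))"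
    unfolding T0_def
    by (subst T0.Tri_finsum)
      (use f g h in \<open>auto simp: finsum_module_reduct finsum_opposite_algebra
        simp del: operator_algebra_simps(2)\<close>)
  also have "\<dots> = \<Delta> n (x \<otimes>\<^bsub>T\<^esub> y)"
    unfolding fsum[symmetric] gsum[symmetric] hsum[symmetric] by (simp add: \<Delta>_def xy)
  finally show ?thesis ..
qed

lemma \<Delta>_higher_derivation: "higher_derivation_into R T T0 \<iota> \<Delta>"
  unfolding higher_derivation_into_def
proof (intro conjI allI ballI \<Delta>_linear \<Delta>_mult)
  fix x assume "x \<in> carrier T"
  then show "\<Delta> 0 x = \<iota> x"
    by (auto simp: \<Delta>_def \<iota>_def component_0 P_def Q_def D_def lmul_def rmul_def lact_closed ract_closed
        lact_zero_left ract_zero_right a_minus_def intro!: restrict_ext)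
qed

lemma Z_add:
  assumes x: "x \<in> carrier T" and y: "y \<in> carrier T"
  shows "Z n (x \<oplus>\<^bsub>T\<^esub> y) = (\<lambda>m\<in>carrier M. Z n x m \<oplus>\<^bsub>M\<^esub> Z n y m)"
proof -
  obtain a m b a' m' b' where xy: "x = (a, m, b)" "y = (a', m', b')"
    and cl: "a \<in> carrier A" "b \<in> carrier B" "a' \<in> carrier A" "b' \<in> carrier B"
    using x y by auto
  have "pA n (inB (b \<oplus>\<^bsub>B\<^esub> b')) = pA n (inB b) \<oplus>\<^bsub>A\<^esub> pA n (inB b')"
    "pB n (inA (a \<oplus>\<^bsub>A\<^esub> a')) = pB n (inA a) \<oplus>\<^bsub>B\<^esub> pB n (inA a')"
    using cl by (simp_all add: corners_linear component_add del: Tri_simps)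
  then show ?thesis
    using cl
    by (auto simp: xy Z_def lmul_def rmul_def component_closed lact_closed ract_closed
        lact_add_left ract_add_right M.a_ac intro!: restrict_ext)
qed

lemma Z_smult:
  assumes c: "c \<in> carrier R" and x: "x \<in> carrier T"
  shows "Z n (c \<odot>\<^bsub>T\<^esub> x) = (\<lambda>m\<in>carrier M. c \<odot>\<^bsub>M\<^esub> Z n x m)"
proof -
  obtain a m b where xy: "x = (a, m, b)" and cl: "a \<in> carrier A" "b \<in> carrier B"
    using x by auto
  have "pA n (inB (c \<odot>\<^bsub>B\<^esub> b)) = c \<odot>\<^bsub>A\<^esub> pA n (inB b)"
    "pB n (inA (c \<odot>\<^bsub>A\<^esub> a)) = c \<odot>\<^bsub>B\<^esub> pB n (inA a)"
    using cl c by (simp_all add: corners_linear component_smult del: Tri_simps)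
  then show ?thesis
    using cl c
    by (auto simp: xy Z_def lmul_def rmul_def component_closed lact_closed ract_closed
        smult_lact_left smult_ract_right M.smult_r_distr intro!: restrict_ext)
qed

lemma \<chi>_linear: "\<chi> n \<in> linear_maps R T T0"
proof (rule linear_mapsI)
  show "\<chi> n x \<in> carrier T0" if "x \<in> carrier T" for x
    using that by (simp add: T0_def \<chi>_def Z_A0 Z_B0)
qed (simp_all add: T0_def \<chi>_def Z_add Z_smult del: Tri_simps(1))

lemma \<chi>_center: "\<chi> n \<in> carrier T \<rightarrow> center T0"
proof
  fix x assume "x \<in> carrier T"
  then show "\<chi> n x \<in> center T0"
    using M.diagonal_central[of "Z n x" "rmul ` carrier B \<union> lmul ` center A"]
      Z_A0[of x n] Z_B0[of x n]
    by (simp add: T0_def A0_def B0_def \<chi>_def)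
qed

text \<open>
  \<open>Z\<close> is made of the entries that \<open>L\<close> sends from one diagonal corner into the other.  These are
  central, so the Lie identity writes their values on commutators as sums of zero commutators.
\<close>

lemma \<chi>_commutator:
  assumes x: "x \<in> carrier T" and y: "y \<in> carrier T"
  shows "\<chi> n (commutator T x y) = \<zero>\<^bsub>T0\<^esub>"
proof -
  obtain a m b a' m' b' where xy: "x = (a, m, b)" "y = (a', m', b')"
    and cl: "a \<in> carrier A" "m \<in> carrier M" "b \<in> carrier B"
      "a' \<in> carrier A" "m' \<in> carrier M" "b' \<in> carrier B"
    using x y by auto
  have "pB n (inA (commutator A a a')) =
      (\<Oplus>\<^bsub>B\<^esub>i\<in>{..n}. commutator B (pB i (inA a)) (pB (n - i) (inA a')))"
    using component_commutator(3)[of "inA a" "inA a'" n] cl by (simp add: commutator_corners)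
  also have "\<dots> = \<zero>\<^bsub>B\<^esub>"
    by (rule B.add.finprod_one_eqI) (simp add: B.commutator_center center_pB_inA component_closed cl)
  finally have pB0: "pB n (inA (commutator A a a')) = \<zero>\<^bsub>B\<^esub>" .
  have "pA n (inB (commutator B b b')) =
      (\<Oplus>\<^bsub>A\<^esub>i\<in>{..n}. commutator A (pA i (inB b)) (pA (n - i) (inB b')))"
    using component_commutator(1)[of "inB b" "inB b'" n] cl by (simp add: commutator_corners)
  also have "\<dots> = \<zero>\<^bsub>A\<^esub>"
    by (rule A.add.finprod_one_eqI) (simp add: A.commutator_center center_pA_inB component_closed cl)
  finally have pA0: "pA n (inB (commutator B b b')) = \<zero>\<^bsub>A\<^esub>" .
  show ?thesis
    using cl
    by (auto simp: xy Tri_commutator \<chi>_def Z_def pA0 pB0 T0_def lmul_def rmul_def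
        lact_zero_left ract_zero_right intro!: restrict_ext)
qed

text \<open>
  The right action of \<open>pB (inA a)\<close> is subtracted in \<open>P\<close> and restored by \<open>Z\<close>, and likewise for the
  left action of \<open>pA (inB b)\<close> in \<open>Q\<close>.
\<close>

lemma \<iota>_L:
  assumes x: "x \<in> carrier T"
  shows "\<iota> (L n x) = \<Delta> n x \<oplus>\<^bsub>T0\<^esub> \<chi> n x"
proof -
  obtain a m b where xy: "x = (a, m, b)"
    and cl: "a \<in> carrier A" "m \<in> carrier M" "b \<in> carrier B"
    using x by auto
  have cancel: "(u \<ominus>\<^bsub>M\<^esub> v) \<oplus>\<^bsub>M\<^esub> (v \<oplus>\<^bsub>M\<^esub> w) = u \<oplus>\<^bsub>M\<^esub> w"
    if "u \<in> carrier M" "v \<in> carrier M" "w \<in> carrier M" for u v w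
    using that M.add_diff_telescope[of "\<zero>\<^bsub>M\<^esub>" "\<zero>\<^bsub>M\<^esub>" u v "\<ominus>\<^bsub>M\<^esub> w"]
    by (simp add: a_minus_def)
  have "pA n x = pA n (inA a) \<oplus>\<^bsub>A\<^esub> pA n (inB b)" "pB n x = pB n (inA a) \<oplus>\<^bsub>B\<^esub> pB n (inB b)"
    using component_decomposition(1,2)[of a m b n] x by (simp_all only: xy)
  note px = this
  have "lmul (pA n x) = (\<lambda>m'\<in>carrier M. P n a m' \<oplus>\<^bsub>M\<^esub> Z n x m')"
    unfolding px using cl
    by (auto simp: xy lmul_def rmul_def Z_def P_def D_def component_closed lact_add_left
        cancel lact_closed ract_closed intro!: restrict_ext)
  moreover have "rmul (pB n x) = (\<lambda>m'\<in>carrier M. Q n b m' \<oplus>\<^bsub>M\<^esub> Z n x m')"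
  proof -
    have "Z n x m' = lmul (pA n (inB b)) m' \<oplus>\<^bsub>M\<^esub> rmul (pB n (inA a)) m'" if "m' \<in> carrier M" for m'
      using cl that
      by (simp add: xy Z_def lmul_def rmul_def lact_closed ract_closed component_closed M.a_comm)
    then show ?thesis
      unfolding px using cl
      by (auto simp: lmul_def rmul_def Q_apply component_closed ract_add_right
          cancel M.a_comm lact_closed ract_closed intro!: restrict_ext)
  qed
  ultimately show ?thesis
    using x component_closed(2)[of "x" n] unfolding L_eq[of n x] by (simp add: \<iota>_def \<Delta>_def \<chi>_def T0_def xy)
qed

end

theorem theorem3p1:
  fixes R :: "('r, 'k) ring_scheme"
    and A :: "('r, 'a, 'x) module_scheme"
    and M :: "('r, 'm, 'y) module_scheme"
    and B :: "('r, 'b, 'z) module_scheme"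
    and lact :: "'a \<Rightarrow> 'm \<Rightarrow> 'm"
    and ract :: "'m \<Rightarrow> 'b \<Rightarrow> 'm"
    and L :: "nat \<Rightarrow> 'a \<times> 'm \<times> 'b \<Rightarrow> 'a \<times> 'm \<times> 'b"
  defines "T \<equiv> Tri A M B lact ract"
  assumes "triangular R A M B lact ract"
    and "lie_higher_derivation R T L"
  shows "\<exists>(A0 :: ('r, 'm \<Rightarrow> 'm) module) (M0 :: ('r, 'm) module) (B0 :: ('r, 'm \<Rightarrow> 'm) module)
            lact0 ract0 T0 \<iota> \<Delta> \<chi>.
           triangular R A0 M0 B0 lact0 ract0 \<and>
           T0 = Tri A0 M0 B0 lact0 ract0 \<and>
           algebra_embedding R T T0 \<iota> \<and>
           higher_derivation_into R T T0 \<iota> \<Delta> \<and>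
           (\<forall>n. \<chi> n \<in> linear_maps R T T0 \<and> \<chi> n \<in> carrier T \<rightarrow> center T0) \<and>
           (\<forall>n. \<forall>x \<in> carrier T. \<forall>y \<in> carrier T. \<chi> n (commutator T x y) = \<zero>\<^bsub>T0\<^esub>) \<and>
           (\<forall>n. \<forall>x \<in> carrier T. \<iota> (L n x) = \<Delta> n x \<oplus>\<^bsub>T0\<^esub> \<chi> n x)"
proof -
  interpret triangular_lie_higher_derivation R A M B lact ract L
    using assms
    by (intro triangular_lie_higher_derivation.intro triangular_lie_higher_derivation_axioms.intro)
      simp_all
  show ?thesis
    unfolding T_def
    by (rule exI[of _ "operator_algebra M A0"], rule exI[of _ "module_reduct M"],
        rule exI[of _ "opposite_algebra (operator_algebra M B0)"],
        rule exI[of _ "\<lambda>f m. f m"], rule exI[of _ "\<lambda>m g. g m"],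
        rule exI[of _ T0], rule exI[of _ \<iota>], rule exI[of _ \<Delta>], rule exI[of _ \<chi>])
      (intro conjI allI ballI triangular_T0 T0_def \<iota>_embedding \<Delta>_higher_derivation
        \<chi>_linear \<chi>_center \<chi>_commutator \<iota>_L)
qed

end
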